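(* Let $C\subseteq\mathbb{N}$ be hyperarithmetical. Then there is a computable map $n\mapsto\|\cdot\|_n$ from $\mathbb{N}$ to the set of norms on $N$ such that for all $n\in\mathbb{N}$: the three closed balls of radius $1$ around $(2,0,\Theta)$, $(0,2,\Theta)$ and $(2,2,\Theta)$ have nonempty intersection in the $\|\cdot\|_n$-completion of $N$ if and only if $n\in C$.
   Context: $\mathbb{N}$ starts with $0$. $N$ (not to be confused with $\mathbb{N}$) is the vector space over $\mathbb{Q}$ of all functions $\mathbb{N}\to\mathbb{Q}$ with finite support, coded effectively by natural numbers, and $\Theta$ is its zero element. $\mathbb{Q}^2\times N$ is identified with $N$ via $(q_0,q_1,v)\mapsto(q_0,q_1,v_0,v_1,\dots)$, so that $(2,0,\Theta)$, $(0,2,\Theta)$, $(2,2,\Theta)$ are elements of $N$. A norm on $N$ is a function $\|\cdot\|:N\to\mathbb{Q}$ satisfying the norm axioms over $\mathbb{Q}$ (with $\|v\|=0$ only for $v=\Theta$); the completion of $N$ under it is a real Banach space. The map $n\mapsto\|\cdot\|_n$ is computable if $(n,v)\mapsto\|v\|_n\in\mathbb{Q}$ is computable. Hyperarithmetical subsets of $\mathbb{N}$ are the $\Delta^1_1$ sets. *)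

theory Defs
  imports "HOL-Analysis.Analysis" "HOL-Library.Poly_Mapping" "HOL-Library.Countable"
    "HOL-Library.Nat_Bijection"
begin

section \<open>Computable functions on the natural numbers\<close>

text \<open>
  General recursive functions of arity \<open>n\<close>, as functions on lists of length \<open>n\<close>.
  Minimization is only applied to regular functions, so all functions are total.
  By the last rule only the values on lists of the right length matter.
\<close>

inductive general_recursive :: "nat \<Rightarrow> (nat list \<Rightarrow> nat) \<Rightarrow> bool" where
  gr_zero: "general_recursive n (\<lambda>xs. 0)"
| gr_succ: "general_recursive 1 (\<lambda>xs. Suc (xs ! 0))"
| gr_proj: "i < n \<Longrightarrow> general_recursive n (\<lambda>xs. xs ! i)"
| gr_comp: "general_recursive (length gs) f \<Longrightarrow> (\<forall>g\<in>set gs. general_recursive n g) \<Longrightarrow>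
    general_recursive n (\<lambda>xs. f (map (\<lambda>g. g xs) gs))"
| gr_primrec: "general_recursive n f \<Longrightarrow> general_recursive (Suc (Suc n)) g \<Longrightarrow>
    general_recursive (Suc n)
      (\<lambda>xs. rec_nat (f (tl xs)) (\<lambda>y r. g (y # r # tl xs)) (hd xs))"
| gr_mu: "general_recursive (Suc n) f \<Longrightarrow> (\<forall>xs. length xs = n \<longrightarrow> (\<exists>y. f (y # xs) = 0)) \<Longrightarrow>
    general_recursive n (\<lambda>xs. LEAST y. f (y # xs) = 0)"
| gr_ext: "general_recursive n f \<Longrightarrow> (\<forall>xs. length xs = n \<longrightarrow> g xs = f xs) \<Longrightarrow>
    general_recursive n g"


section \<open>Hyperarithmetical sets\<close>

text \<open>
  Arithmetical formulas of second-order arithmetic: number quantifiers only, with set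
  variables as parameters. In \<open>Mem t i\<close>, the number \<open>i\<close> is the name of a set variable.
\<close>

datatype arith_term =
    Var nat
  | Zero
  | Succ arith_term
  | Plus arith_term arith_term
  | Times arith_term arith_term

datatype arith_formula =
    Eq arith_term arith_term
  | Less arith_term arith_term
  | Mem arith_term nat
  | Neg arith_formula
  | Conj arith_formula arith_formula
  | Exists nat arith_formula

primrec term_val :: "(nat \<Rightarrow> nat) \<Rightarrow> arith_term \<Rightarrow> nat" where
  "term_val e (Var i) = e i"
| "term_val e Zero = 0"
| "term_val e (Succ t) = Suc (term_val e t)"
| "term_val e (Plus s t) = term_val e s + term_val e t"
| "term_val e (Times s t) = term_val e s * term_val e t"

primrec holds :: "(nat \<Rightarrow> nat set) \<Rightarrow> (nat \<Rightarrow> nat) \<Rightarrow> arith_formula \<Rightarrow> bool" where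
  "holds X e (Eq s t) \<longleftrightarrow> term_val e s = term_val e t"
| "holds X e (Less s t) \<longleftrightarrow> term_val e s < term_val e t"
| "holds X e (Mem t i) \<longleftrightarrow> term_val e t \<in> X i"
| "holds X e (Neg \<phi>) \<longleftrightarrow> \<not> holds X e \<phi>"
| "holds X e (Conj \<phi> \<psi>) \<longleftrightarrow> holds X e \<phi> \<and> holds X e \<psi>"
| "holds X e (Exists i \<phi>) \<longleftrightarrow> (\<exists>a. holds X (e(i := a)) \<phi>)"

text \<open>
  Since a formula contains only finitely many set variables, quantifying over a whole
  assignment \<open>X\<close> of sets amounts to a finite block of set quantifiers. All free number
  variables are interpreted by the argument \<open>n\<close>.
\<close>

definition Sigma11 :: "nat set \<Rightarrow> bool" where
  "Sigma11 C \<longleftrightarrow> (\<exists>\<phi>. \<forall>n. n \<in> C \<longleftrightarrow> (\<exists>X. holds X (\<lambda>_. n) \<phi>))"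

definition Pi11 :: "nat set \<Rightarrow> bool" where
  "Pi11 C \<longleftrightarrow> (\<exists>\<phi>. \<forall>n. n \<in> C \<longleftrightarrow> (\<forall>X. holds X (\<lambda>_. n) \<phi>))"

definition hyperarithmetical :: "nat set \<Rightarrow> bool" where
  "hyperarithmetical C \<longleftrightarrow> Sigma11 C \<and> Pi11 C"


section \<open>The space of finitely supported rational sequences and its norms\<close>

type_synonym N = "nat \<Rightarrow>\<^sub>0 rat"

definition scale :: "rat \<Rightarrow> N \<Rightarrow> N" where
  "scale q v = Poly_Mapping.map (\<lambda>x. q * x) v"

lemma lookup_scale [simp]: "Poly_Mapping.lookup (scale q v) i = q * Poly_Mapping.lookup v i"
  by (simp add: scale_def Poly_Mapping.map.rep_eq when_def)

definition rat_norm :: "(N \<Rightarrow> rat) \<Rightarrow> bool" where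
  "rat_norm p \<longleftrightarrow>
     (\<forall>v. 0 \<le> p v) \<and>
     (\<forall>v. p v = 0 \<longleftrightarrow> v = 0) \<and>
     (\<forall>q v. p (scale q v) = \<bar>q\<bar> * p v) \<and>
     (\<forall>v w. p (v + w) \<le> p v + p w)"

text \<open>The identification \<open>(q\<^sub>0, q\<^sub>1, v) \<mapsto> (q\<^sub>0, q\<^sub>1, v\<^sub>0, v\<^sub>1, \<dots>)\<close>.\<close>

lift_definition prepend2 :: "rat \<Rightarrow> rat \<Rightarrow> N \<Rightarrow> N" is
  "\<lambda>q\<^sub>0 q\<^sub>1 v. case_nat q\<^sub>0 (case_nat q\<^sub>1 v)"
proof -
  fix q\<^sub>0 q\<^sub>1 :: rat and v :: "nat \<Rightarrow> rat"
  assume fin: "finite {i. v i \<noteq> 0}"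
  have "i \<in> {0, 1} \<union> (\<lambda>i. Suc (Suc i)) ` {i. v i \<noteq> 0}"
    if "case_nat q\<^sub>0 (case_nat q\<^sub>1 v) i \<noteq> 0" for i
  proof (cases i)
    case (Suc j)
    with that show ?thesis
      by (cases j) auto
  qed simp
  then have "{i. case_nat q\<^sub>0 (case_nat q\<^sub>1 v) i \<noteq> 0} \<subseteq> {0, 1} \<union> (\<lambda>i. Suc (Suc i)) ` {i. v i \<noteq> 0}"
    by blast
  then show "finite {i. case_nat q\<^sub>0 (case_nat q\<^sub>1 v) i \<noteq> 0}"
    by (rule finite_subset) (use fin in simp)
qed

lemma lookup_prepend2:
  "Poly_Mapping.lookup (prepend2 q\<^sub>0 q\<^sub>1 v) 0 = q\<^sub>0"
  "Poly_Mapping.lookup (prepend2 q\<^sub>0 q\<^sub>1 v) (Suc 0) = q\<^sub>1"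
  "Poly_Mapping.lookup (prepend2 q\<^sub>0 q\<^sub>1 v) (Suc (Suc i)) = Poly_Mapping.lookup v i"
  by (simp_all add: prepend2.rep_eq)

text \<open>
  Coding: rationals are coded by the surjection \<^const>\<open>nat_to_rat_surj\<close> of the library, and
  elements of \<^typ>\<open>N\<close> by finite lists of coefficients. Codes are not unique.
\<close>

definition decode_N :: "nat \<Rightarrow> N" where
  "decode_N c = Poly_Mapping.nth (map nat_to_rat_surj (list_decode c))"

lemma surj_decode_N: "surj decode_N"
proof (rule surjI)
  fix v :: N
  let ?code = "\<lambda>q. SOME k. nat_to_rat_surj k = q"
  have code: "nat_to_rat_surj (?code q) = q" for q
    by (rule someI_ex) (metis surj_nat_to_rat_surj surjD)
  have "Poly_Mapping.nth (map (Poly_Mapping.lookup v) [0..<Poly_Mapping.degree v]) = v"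
  proof (rule poly_mapping_eqI)
    fix i
    show "Poly_Mapping.lookup (Poly_Mapping.nth (map (Poly_Mapping.lookup v) [0..<Poly_Mapping.degree v])) i = Poly_Mapping.lookup v i"
      by (cases "i < Poly_Mapping.degree v")
        (auto simp: Poly_Mapping.nth.rep_eq nth_default_def beyond_degree_lookup_zero)
  qed
  then show "decode_N (list_encode (map (\<lambda>i. ?code (Poly_Mapping.lookup v i)) [0..<Poly_Mapping.degree v])) = v"
    by (simp add: decode_N_def comp_def code)
qed

definition computable_norms :: "(nat \<Rightarrow> N \<Rightarrow> rat) \<Rightarrow> bool" where
  "computable_norms p \<longleftrightarrow>
     (\<exists>f. general_recursive 2 f \<and> (\<forall>n c. p n (decode_N c) = nat_to_rat_surj (f [n, c])))"


section \<open>Completion\<close>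

text \<open>
  The completion of a metric space \<open>(UNIV, d)\<close>: Cauchy sequences modulo distance tending
  to \<open>0\<close>. Only the metric of the completion of a normed space is needed for closed balls.
\<close>

definition cauchy_equiv :: "('a \<Rightarrow> 'a \<Rightarrow> real) \<Rightarrow> ((nat \<Rightarrow> 'a) \<times> (nat \<Rightarrow> 'a)) set" where
  "cauchy_equiv d = {(\<sigma>, \<tau>). Metric_space.MCauchy UNIV d \<sigma> \<and> Metric_space.MCauchy UNIV d \<tau> \<and>
     (\<lambda>k. d (\<sigma> k) (\<tau> k)) \<longlonglongrightarrow> 0}"

definition completion_space :: "('a \<Rightarrow> 'a \<Rightarrow> real) \<Rightarrow> (nat \<Rightarrow> 'a) set set" where
  "completion_space d = {\<sigma>. Metric_space.MCauchy UNIV d \<sigma>} // cauchy_equiv d"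

definition completion_dist ::
    "('a \<Rightarrow> 'a \<Rightarrow> real) \<Rightarrow> (nat \<Rightarrow> 'a) set \<Rightarrow> (nat \<Rightarrow> 'a) set \<Rightarrow> real" where
  "completion_dist d A B =
     (if A \<in> completion_space d \<and> B \<in> completion_space d
      then lim (\<lambda>k. d ((SOME \<sigma>. \<sigma> \<in> A) k) ((SOME \<tau>. \<tau> \<in> B) k)) else 0)"

definition completion_embed :: "('a \<Rightarrow> 'a \<Rightarrow> real) \<Rightarrow> 'a \<Rightarrow> (nat \<Rightarrow> 'a) set" where
  "completion_embed d a = cauchy_equiv d `` {\<lambda>_. a}"

definition norm_dist :: "(N \<Rightarrow> rat) \<Rightarrow> N \<Rightarrow> N \<Rightarrow> real" where
  "norm_dist p v w = real_of_rat (p (v - w))"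

definition completion_cball :: "(N \<Rightarrow> rat) \<Rightarrow> N \<Rightarrow> real \<Rightarrow> (nat \<Rightarrow> N) set set" where
  "completion_cball p v r =
     Metric_space.mcball (completion_space (norm_dist p)) (completion_dist (norm_dist p))
       (completion_embed (norm_dist p) v) r"


subsection \<open>Adequacy of the construction\<close>

lemma Metric_space_norm_dist:
  assumes "rat_norm p"
  shows "Metric_space UNIV (norm_dist p)"
proof
  fix u v w :: N
  show "0 \<le> norm_dist p u v"
    using assms by (simp add: norm_dist_def rat_norm_def)
  have "scale (-1) (u - v) = v - u"
    by (rule poly_mapping_eqI) (simp add: lookup_minus)
  moreover have "p (scale (-1) (u - v)) = \<bar>-1\<bar> * p (u - v)"
    using assms unfolding rat_norm_def by blast
  ultimately show "norm_dist p u v = norm_dist p v u"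
    by (simp add: norm_dist_def)
  show "norm_dist p u v = 0 \<longleftrightarrow> u = v"
    using assms by (simp add: norm_dist_def rat_norm_def)
  have "p ((u - v) + (v - w)) \<le> p (u - v) + p (v - w)"
    using assms unfolding rat_norm_def by blast
  then have "p (u - w) \<le> p (u - v) + p (v - w)"
    by simp
  then show "norm_dist p u w \<le> norm_dist p u v + norm_dist p v w"
    unfolding norm_dist_def by (metis of_rat_add of_rat_less_eq)
qed

context
  fixes d :: "'a \<Rightarrow> 'a \<Rightarrow> real"
  assumes ms: "Metric_space UNIV d"
begin

interpretation Metric_space UNIV d by (rule ms)

lemma dist_convergent:
  assumes "MCauchy \<sigma>" "MCauchy \<tau>"
  shows "convergent (\<lambda>k. d (\<sigma> k) (\<tau> k))"
proof -
  have "Cauchy (\<lambda>k. d (\<sigma> k) (\<tau> k))"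
    unfolding Cauchy_def
  proof (intro allI impI)
    fix e :: real assume "e > 0"
    obtain K1 where K1: "\<And>m n. K1 \<le> m \<Longrightarrow> K1 \<le> n \<Longrightarrow> d (\<sigma> m) (\<sigma> n) < e/2"
      using assms(1) \<open>e > 0\<close> unfolding MCauchy_def by (meson half_gt_zero)
    obtain K2 where K2: "\<And>m n. K2 \<le> m \<Longrightarrow> K2 \<le> n \<Longrightarrow> d (\<tau> m) (\<tau> n) < e/2"
      using assms(2) \<open>e > 0\<close> unfolding MCauchy_def by (meson half_gt_zero)
    have "dist (d (\<sigma> m) (\<tau> m)) (d (\<sigma> n) (\<tau> n)) < e" if "m \<ge> max K1 K2" "n \<ge> max K1 K2" for m n
    proof -
      have "d (\<sigma> m) (\<sigma> n) < e/2" "d (\<tau> m) (\<tau> n) < e/2"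
        using K1 K2 that by auto
      moreover have "d (\<sigma> m) (\<tau> m) \<le> d (\<sigma> m) (\<sigma> n) + d (\<sigma> n) (\<tau> n) + d (\<tau> n) (\<tau> m)"
        using triangle[of "\<sigma> m" "\<sigma> n" "\<tau> m"] triangle[of "\<sigma> n" "\<tau> n" "\<tau> m"] by simp
      moreover have "d (\<sigma> n) (\<tau> n) \<le> d (\<sigma> n) (\<sigma> m) + d (\<sigma> m) (\<tau> m) + d (\<tau> m) (\<tau> n)"
        using triangle[of "\<sigma> n" "\<sigma> m" "\<tau> n"] triangle[of "\<sigma> m" "\<tau> m" "\<tau> n"] by simp
      ultimately show ?thesis
        using commute[of "\<sigma> n" "\<sigma> m"] commute[of "\<tau> n" "\<tau> m"] by (simp add: dist_real_def)
    qed
    then show "\<exists>M. \<forall>m\<ge>M. \<forall>n\<ge>M. dist (d (\<sigma> m) (\<tau> m)) (d (\<sigma> n) (\<tau> n)) < e"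
      by blast
  qed
  then show ?thesis
    by (simp add: Cauchy_convergent)
qed

lemma equiv_cauchy_equiv: "equiv {\<sigma>. MCauchy \<sigma>} (cauchy_equiv d)"
proof (rule equivI)
  show "cauchy_equiv d \<subseteq> {\<sigma>. MCauchy \<sigma>} \<times> {\<sigma>. MCauchy \<sigma>}"
    by (auto simp: cauchy_equiv_def)
  show "refl_on {\<sigma>. MCauchy \<sigma>} (cauchy_equiv d)"
    by (auto simp: refl_on_def cauchy_equiv_def)
  show "sym (cauchy_equiv d)"
    by (auto simp: sym_def cauchy_equiv_def commute)
  show "trans (cauchy_equiv d)"
  proof (rule transI)
    fix \<rho> \<sigma> \<tau>
    assume a: "(\<rho>, \<sigma>) \<in> cauchy_equiv d" "(\<sigma>, \<tau>) \<in> cauchy_equiv d"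
    then have "(\<lambda>k. d (\<rho> k) (\<sigma> k) + d (\<sigma> k) (\<tau> k)) \<longlonglongrightarrow> 0 + 0"
      by (intro tendsto_add) (auto simp: cauchy_equiv_def)
    then have sum: "(\<lambda>k. d (\<rho> k) (\<sigma> k) + d (\<sigma> k) (\<tau> k)) \<longlonglongrightarrow> 0"
      by simp
    have "(\<lambda>k. d (\<rho> k) (\<tau> k)) \<longlonglongrightarrow> 0"
      by (rule tendsto_sandwich[OF _ _ tendsto_const sum]) (simp_all add: triangle)
    then show "(\<rho>, \<tau>) \<in> cauchy_equiv d"
      using a by (auto simp: cauchy_equiv_def)
  qed
qed

lemma completion_memD:
  assumes "A \<in> completion_space d" "\<sigma> \<in> A"
  shows "MCauchy \<sigma>" "A = cauchy_equiv d `` {\<sigma>}"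
proof -
  show "MCauchy \<sigma>"
    using in_quotient_imp_subset[OF equiv_cauchy_equiv] assms unfolding completion_space_def by blast
  obtain \<tau> where A: "A = cauchy_equiv d `` {\<tau>}"
    using assms(1) unfolding completion_space_def by (rule quotientE)
  then have "(\<tau>, \<sigma>) \<in> cauchy_equiv d"
    using assms(2) by simp
  then show "A = cauchy_equiv d `` {\<sigma>}"
    using A equiv_class_eq[OF equiv_cauchy_equiv] by metis
qed

lemma completion_nonempty: "A \<in> completion_space d \<Longrightarrow> \<exists>\<sigma>. \<sigma> \<in> A"
  using in_quotient_imp_non_empty[OF equiv_cauchy_equiv] unfolding completion_space_def by blast

lemma class_in_completion: "MCauchy \<sigma> \<Longrightarrow> cauchy_equiv d `` {\<sigma>} \<in> completion_space d"
  by (simp add: completion_space_def quotientI)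

lemma self_in_class: "MCauchy \<sigma> \<Longrightarrow> \<sigma> \<in> cauchy_equiv d `` {\<sigma>}"
  by (simp add: cauchy_equiv_def)

lemma completion_dist_tendsto:
  assumes A: "A \<in> completion_space d" and B: "B \<in> completion_space d" and "\<sigma> \<in> A" "\<tau> \<in> B"
  shows "(\<lambda>k. d (\<sigma> k) (\<tau> k)) \<longlonglongrightarrow> completion_dist d A B"
proof -
  define \<sigma>' where "\<sigma>' = (SOME \<sigma>. \<sigma> \<in> A)"
  define \<tau>' where "\<tau>' = (SOME \<tau>. \<tau> \<in> B)"
  have mem: "\<sigma>' \<in> A" "\<tau>' \<in> B"
    unfolding \<sigma>'_def \<tau>'_def using completion_nonempty[OF A] completion_nonempty[OF B] by (auto simp: some_in_eq)
  have C: "MCauchy \<sigma>" "MCauchy \<tau>" "MCauchy \<sigma>'" "MCauchy \<tau>'"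
    using assms mem completion_memD(1) by blast+
  have lim': "(\<lambda>k. d (\<sigma>' k) (\<tau>' k)) \<longlonglongrightarrow> completion_dist d A B"
    using dist_convergent[OF C(3,4)] A B unfolding completion_dist_def \<sigma>'_def \<tau>'_def
    by (simp add: convergent_LIMSEQ_iff)
  have "(\<sigma>, \<sigma>') \<in> cauchy_equiv d" "(\<tau>, \<tau>') \<in> cauchy_equiv d"
    using completion_memD(2)[OF A \<open>\<sigma> \<in> A\<close>] completion_memD(2)[OF B \<open>\<tau> \<in> B\<close>] mem by auto
  then have "(\<lambda>k. d (\<sigma> k) (\<sigma>' k) + d (\<tau> k) (\<tau>' k)) \<longlonglongrightarrow> 0 + 0"
    by (intro tendsto_add) (auto simp: cauchy_equiv_def)
  then have sum: "(\<lambda>k. d (\<sigma> k) (\<sigma>' k) + d (\<tau> k) (\<tau>' k)) \<longlonglongrightarrow> 0"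
    by simp
  have bound: "\<bar>d (\<sigma> k) (\<tau> k) - d (\<sigma>' k) (\<tau>' k)\<bar> \<le> d (\<sigma> k) (\<sigma>' k) + d (\<tau> k) (\<tau>' k)" for k
    using triangle[of "\<sigma> k" "\<sigma>' k" "\<tau> k"] triangle[of "\<sigma>' k" "\<tau>' k" "\<tau> k"]
      triangle[of "\<sigma>' k" "\<sigma> k" "\<tau>' k"] triangle[of "\<sigma> k" "\<tau> k" "\<tau>' k"]
      commute[of "\<sigma> k" "\<sigma>' k"] commute[of "\<tau> k" "\<tau>' k"] by simp
  have "(\<lambda>k. d (\<sigma> k) (\<tau> k) - d (\<sigma>' k) (\<tau>' k)) \<longlonglongrightarrow> 0"
    by (rule Lim_null_comparison[OF _ sum]) (simp add: bound)
  from tendsto_add[OF this lim'] show ?thesis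
    by simp
qed

lemma MCauchy_const: "MCauchy (\<lambda>_. a)"
  by (auto simp: MCauchy_def)

lemma completion_embed_in: "completion_embed d a \<in> completion_space d"
  by (simp add: completion_embed_def class_in_completion MCauchy_const)

lemma const_in_completion_embed: "(\<lambda>_. a) \<in> completion_embed d a"
  by (simp only: completion_embed_def MCauchy_const self_in_class)

lemma completion_embed_isometry:
  "completion_dist d (completion_embed d a) (completion_embed d b) = d a b"
  using completion_dist_tendsto[OF completion_embed_in completion_embed_in
      const_in_completion_embed const_in_completion_embed, of a b]
  by (simp add: LIMSEQ_const_iff)

lemma Metric_space_completion: "Metric_space (completion_space d) (completion_dist d)"
proof
  fix A B
  show comm: "completion_dist d A B = completion_dist d B A"
    by (simp add: completion_dist_def commute)
  show "0 \<le> completion_dist d A B"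
  proof (cases "A \<in> completion_space d \<and> B \<in> completion_space d")
    case True
    then obtain \<sigma> \<tau> where "\<sigma> \<in> A" "\<tau> \<in> B"
      using completion_nonempty by blast
    then have "(\<lambda>k. d (\<sigma> k) (\<tau> k)) \<longlonglongrightarrow> completion_dist d A B"
      using True completion_dist_tendsto by blast
    then show ?thesis
      by (rule LIMSEQ_le_const) auto
  qed (auto simp: completion_dist_def)
next
  fix A B assume AB: "A \<in> completion_space d" "B \<in> completion_space d"
  then obtain \<sigma> \<tau> where st: "\<sigma> \<in> A" "\<tau> \<in> B"
    using completion_nonempty by blast
  have lim: "(\<lambda>k. d (\<sigma> k) (\<tau> k)) \<longlonglongrightarrow> completion_dist d A B"
    using completion_dist_tendsto[OF AB st] .
  have C: "MCauchy \<sigma>" "MCauchy \<tau>"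
    using AB st completion_memD(1) by blast+
  show "completion_dist d A B = 0 \<longleftrightarrow> A = B"
  proof
    assume "completion_dist d A B = 0"
    with lim C have "(\<sigma>, \<tau>) \<in> cauchy_equiv d"
      by (simp add: cauchy_equiv_def)
    then have "cauchy_equiv d `` {\<sigma>} = cauchy_equiv d `` {\<tau>}"
      by (rule equiv_class_eq[OF equiv_cauchy_equiv])
    then show "A = B"
      using completion_memD(2)[OF AB(1) st(1)] completion_memD(2)[OF AB(2) st(2)] by simp
  next
    assume "A = B"
    then have "(\<lambda>k. d (\<sigma> k) (\<sigma> k)) \<longlonglongrightarrow> completion_dist d A B"
      using completion_dist_tendsto[OF AB(1) AB(1) st(1) st(1)] by simp
    then show "completion_dist d A B = 0"
      by (simp add: LIMSEQ_const_iff)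
  qed
next
  fix A B D assume A: "A \<in> completion_space d" and B: "B \<in> completion_space d" and D: "D \<in> completion_space d"
  obtain \<rho> \<sigma> \<tau> where st: "\<rho> \<in> A" "\<sigma> \<in> B" "\<tau> \<in> D"
    using completion_nonempty[OF A] completion_nonempty[OF B] completion_nonempty[OF D] by blast
  have "(\<lambda>k. d (\<rho> k) (\<sigma> k) + d (\<sigma> k) (\<tau> k)) \<longlonglongrightarrow> completion_dist d A B + completion_dist d B D"
    by (rule tendsto_add[OF completion_dist_tendsto[OF A B st(1,2)] completion_dist_tendsto[OF B D st(2,3)]])
  moreover have "(\<lambda>k. d (\<rho> k) (\<tau> k)) \<longlonglongrightarrow> completion_dist d A D"
    by (rule completion_dist_tendsto[OF A D st(1,3)])
  ultimately show "completion_dist d A D \<le> completion_dist d A B + completion_dist d B D"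
    using LIMSEQ_le triangle UNIV_I by meson
qed

lemma completion_embed_tendsto:
  assumes A: "A \<in> completion_space d" and "\<sigma> \<in> A"
  shows "(\<lambda>k. completion_dist d (completion_embed d (\<sigma> k)) A) \<longlonglongrightarrow> 0"
proof (rule LIMSEQ_I)
  fix e :: real assume "e > 0"
  obtain K where K: "\<And>m n. K \<le> m \<Longrightarrow> K \<le> n \<Longrightarrow> d (\<sigma> m) (\<sigma> n) < e/2"
    using completion_memD(1)[OF assms] \<open>e > 0\<close> unfolding MCauchy_def by (meson half_gt_zero)
  have "completion_dist d (completion_embed d (\<sigma> k)) A \<le> e/2" if "k \<ge> K" for k
  proof (rule LIMSEQ_le_const2)
    show "(\<lambda>j. d (\<sigma> k) (\<sigma> j)) \<longlonglongrightarrow> completion_dist d (completion_embed d (\<sigma> k)) A"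
      using completion_dist_tendsto[OF completion_embed_in A const_in_completion_embed \<open>\<sigma> \<in> A\<close>] .
    show "\<exists>N. \<forall>n\<ge>N. d (\<sigma> k) (\<sigma> n) \<le> e/2"
      using K that less_imp_le by blast
  qed
  moreover have "0 \<le> completion_dist d (completion_embed d (\<sigma> k)) A" for k
    using Metric_space.nonneg[OF Metric_space_completion] .
  ultimately show "\<exists>no. \<forall>k\<ge>no. norm (completion_dist d (completion_embed d (\<sigma> k)) A - 0) < e"
    using \<open>e > 0\<close> by (intro exI[of _ K]) fastforce
qed

lemma completion_dense:
  assumes "A \<in> completion_space d" "e > 0"
  shows "\<exists>a. completion_dist d (completion_embed d a) A < e"
proof -
  obtain \<sigma> where "\<sigma> \<in> A"
    using assms completion_nonempty by blast
  then have "\<forall>\<^sub>F k in sequentially. completion_dist d (completion_embed d (\<sigma> k)) A < e"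
    using completion_embed_tendsto[OF assms(1)] assms(2) order_tendstoD(2) by blast
  then show ?thesis
    by (meson eventually_happens trivial_limit_sequentially)
qed

lemma mcomplete_completion: "Metric_space.mcomplete (completion_space d) (completion_dist d)"
proof -
  interpret c: Metric_space "completion_space d" "completion_dist d"
    by (rule Metric_space_completion)
  let ?i = "completion_embed d"
  show ?thesis
    unfolding c.mcomplete_def
  proof (intro allI impI)
    fix X assume X: "c.MCauchy X"
    then have Xin: "X k \<in> completion_space d" for k
      by (auto simp: c.MCauchy_def)
    have "\<forall>k. \<exists>a. completion_dist d (?i a) (X k) < 1 / real (Suc k)"
      using completion_dense[OF Xin] by simp
    then obtain \<sigma> where \<sigma>: "\<And>k. completion_dist d (?i (\<sigma> k)) (X k) < 1 / real (Suc k)"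
      by metis
    have inv: "(\<lambda>k. 1 / real (Suc k)) \<longlonglongrightarrow> 0"
      using LIMSEQ_inverse_real_of_nat by (simp add: inverse_eq_divide)
    have lim: "(\<lambda>k. completion_dist d (?i (\<sigma> k)) (X k)) \<longlonglongrightarrow> 0"
    proof (rule tendsto_sandwich[OF _ _ tendsto_const inv])
      show "\<forall>\<^sub>F k in sequentially. completion_dist d (?i (\<sigma> k)) (X k) \<le> 1 / real (Suc k)"
        by (intro always_eventually allI less_imp_le[OF \<sigma>])
    qed simp
    have "MCauchy \<sigma>"
      unfolding MCauchy_def
    proof (intro conjI allI impI)
      fix e :: real assume "e > 0"
      obtain K1 where K1: "\<And>m n. K1 \<le> m \<Longrightarrow> K1 \<le> n \<Longrightarrow> completion_dist d (X m) (X n) < e/3"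
        using X \<open>e > 0\<close> unfolding c.MCauchy_def by (meson divide_pos_pos zero_less_numeral)
      have "\<forall>\<^sub>F k in sequentially. completion_dist d (?i (\<sigma> k)) (X k) < e/3"
        using lim \<open>e > 0\<close> order_tendstoD(2) by (metis divide_pos_pos zero_less_numeral)
      then obtain K2 where K2: "\<And>k. K2 \<le> k \<Longrightarrow> completion_dist d (?i (\<sigma> k)) (X k) < e/3"
        by (auto simp: eventually_sequentially)
      have "d (\<sigma> m) (\<sigma> n) < e" if "max K1 K2 \<le> m" "max K1 K2 \<le> n" for m n
      proof -
        have "d (\<sigma> m) (\<sigma> n) = completion_dist d (?i (\<sigma> m)) (?i (\<sigma> n))"
          by (simp add: completion_embed_isometry)
        also have "\<dots> \<le> completion_dist d (?i (\<sigma> m)) (X m) + completion_dist d (X m) (?i (\<sigma> n))"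
          by (intro c.triangle completion_embed_in Xin)
        also have "completion_dist d (X m) (?i (\<sigma> n)) \<le>
            completion_dist d (X m) (X n) + completion_dist d (X n) (?i (\<sigma> n))"
          by (intro c.triangle completion_embed_in Xin)
        finally show ?thesis
          using K1[of m n] K2[of m] K2[of n] that c.commute[of "X n"] by simp
      qed
      then show "\<exists>N. \<forall>n n'. N \<le> n \<longrightarrow> N \<le> n' \<longrightarrow> d (\<sigma> n) (\<sigma> n') < e"
        by blast
    qed simp
    define A where "A = cauchy_equiv d `` {\<sigma>}"
    have A: "A \<in> completion_space d" "\<sigma> \<in> A"
      using \<open>MCauchy \<sigma>\<close> class_in_completion self_in_class by (auto simp: A_def)
    have sum: "(\<lambda>k. completion_dist d (?i (\<sigma> k)) (X k) + completion_dist d (?i (\<sigma> k)) A) \<longlonglongrightarrow> 0"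
      using tendsto_add[OF lim completion_embed_tendsto[OF A]] by simp
    have bound: "completion_dist d (X k) A \<le>
        completion_dist d (?i (\<sigma> k)) (X k) + completion_dist d (?i (\<sigma> k)) A" for k
      using c.triangle[OF Xin completion_embed_in A(1), of k "\<sigma> k"] by (simp add: c.commute)
    have "(\<lambda>k. completion_dist d (X k) A) \<longlonglongrightarrow> 0"
      by (rule tendsto_sandwich[OF _ _ tendsto_const sum]) (auto intro: always_eventually bound)
    then have "limitin c.mtopology X A sequentially"
      using A(1) Xin by (simp add: c.limitin_metric_dist_null)
    then show "\<exists>A. limitin c.mtopology X A sequentially" ..
  qed
qed

end
lemma in_completion_cball:
  assumes "rat_norm p"
  shows "x \<in> completion_cball p v r \<longleftrightarrow> x \<in> completion_space (norm_dist p) \<and>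
    completion_dist (norm_dist p) (completion_embed (norm_dist p) v) x \<le> r"
  unfolding completion_cball_def
  by (simp add: Metric_space.in_mcball Metric_space_completion Metric_space_norm_dist assms
      completion_embed_in)

end

theory Submission
  imports Defs
begin

text \<open>
  A hyperarithmetical set \<open>C\<close> is in particular \<open>\<Sigma>\<^sup>1\<^sub>1\<close>. Hence there are trees \<open>T\<^sub>n\<close> of finite
  sequences, decidable uniformly in \<open>n\<close>, such that \<open>n \<in> C\<close> if and only if \<open>T\<^sub>n\<close> has an infinite
  branch (\<open>Sigma11_normal_form\<close>). The norm number \<open>n\<close> is designed so that a common point of the
  three balls is the same thing as a unit of mass flowing down \<open>T\<^sub>n\<close>. Flows are the right
  substitute for branches: like the intersection of the balls, and unlike the set of branches,
  the set of flows is convex; and it is nonempty exactly if there is a branch.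

  Write a vector as \<open>(x\<^sub>0, x\<^sub>1, y)\<close> with \<open>y\<close> indexed by the nodes of the tree of all finite
  sequences, and let

    \<open>defect y = (\<Sum>s. \<bar>y\<^sub>s / 2 - (\<Sum>t child of s. y\<^sub>t)\<bar>) + (\<Sum>s not in T. \<bar>y\<^sub>s\<bar>)\<close>.

  The norm is the maximum of \<open>\<bar>x\<^sub>0\<bar>\<close>, \<open>\<bar>x\<^sub>1\<bar>\<close>, \<open>\<Sum>s. \<bar>y\<^sub>s\<bar>\<close>, \<open>\<bar>x\<^sub>0 + x\<^sub>1 + (\<Sum>s. y\<^sub>s)\<bar>\<close> and
  \<open>\<bar>x\<^sub>0 - x\<^sub>1\<bar> / 2 + defect y\<close>. Let \<open>(x\<^sub>0, x\<^sub>1, y)\<close> have distance at most \<open>1\<close> from each of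
  \<open>(2, 0, \<Theta>)\<close>, \<open>(0, 2, \<Theta>)\<close> and \<open>(2, 2, \<Theta>)\<close>. The first two terms force \<open>x\<^sub>0 = x\<^sub>1 = 1\<close>. So the
  difference to the first centre is \<open>(1, -1, -y)\<close>, where the last term has no room left for the
  defect: \<open>y\<close> lives on \<open>T\<close> and every node hands exactly half of its mass to its children. The
  difference to the third centre is \<open>(1, 1, -y)\<close>, where the fourth term yields \<open>(\<Sum>s. y\<^sub>s) \<ge> 1\<close>;
  with \<open>(\<Sum>s. \<bar>y\<^sub>s\<bar>) \<le> 1\<close> this means that \<open>y\<close> is nonnegative of total mass \<open>1\<close>. With a node also
  its parent and one of its children have positive mass, so there is an infinite branch of such
  nodes, all of them in \<open>T\<close>. In the completion these relations hold only in the limit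
  (\<open>branch_of_ball_intersection\<close>). Conversely, a branch \<open>s\<^sub>0, s\<^sub>1, \<dots>\<close> of \<open>T\<close> carries the flow with
  mass \<open>1 / 2\<^sup>m\<^sup>+\<^sup>1\<close> at \<open>s\<^sub>m\<close>, whose finite truncations converge in the norm
  (\<open>ball_intersection_of_branch\<close>).

  On finitely supported rational vectors all the sums are finite, so the norm is rational, and
  it is computable because \<open>T\<^sub>n\<close> is decidable.
\<close>

section \<open>Closure properties of the general recursive functions\<close>

text \<open>
  Functions are given by their values on argument lists, so the closure lemmas speak about
  expressions \<open>F xs\<close> in the list \<open>xs\<close> of all arguments. A decidable relation is represented by
  its characteristic function \<^const>\<open>of_bool\<close>. Together the lemmas prove the recursiveness of an
  explicitly defined function by following the structure of its definition.
\<close>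

lemma gr_cong: "general_recursive n f \<Longrightarrow> (\<And>xs. length xs = n \<Longrightarrow> g xs = f xs) \<Longrightarrow> general_recursive n g"
  by (blast intro: gr_ext)

lemma gr_Suc: "general_recursive n F \<Longrightarrow> general_recursive n (\<lambda>xs. Suc (F xs))"
  using gr_comp[of "[F]" "\<lambda>xs. Suc (xs ! 0)" n] gr_succ by simp

lemma gr_const: "general_recursive n (\<lambda>xs. c)"
  by (induction c) (auto intro: gr_zero gr_Suc)

lemma gr_tl:
  assumes "general_recursive n F"
  shows "general_recursive (Suc n) (\<lambda>xs. F (tl xs))"
proof -
  let ?gs = "map (\<lambda>i xs. xs ! Suc i) [0..<n]"
  have "general_recursive (Suc n) (\<lambda>xs. F (map (\<lambda>g. g xs) ?gs))"
    using assms by (intro gr_comp) (auto intro: gr_proj)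
  then show ?thesis
  proof (rule gr_cong)
    fix xs :: "nat list" assume "length xs = Suc n"
    then have "map (\<lambda>g. g xs) ?gs = tl xs"
      by (auto intro!: nth_equalityI simp: nth_tl)
    then show "F (tl xs) = F (map (\<lambda>g. g xs) ?gs)"
      by simp
  qed
qed

lemma gr_Cons:
  assumes "general_recursive (Suc n) F" "general_recursive n B"
  shows "general_recursive n (\<lambda>xs. F (B xs # xs))"
proof -
  let ?gs = "B # map (\<lambda>i xs. xs ! i) [0..<n]"
  have "general_recursive n (\<lambda>xs. F (map (\<lambda>g. g xs) ?gs))"
    using assms by (intro gr_comp) (auto intro: gr_proj)
  then show ?thesis
  proof (rule gr_cong)
    fix xs :: "nat list" assume "length xs = n"
    then have "map (\<lambda>g. g xs) ?gs = B xs # xs"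
      by (auto intro!: nth_equalityI)
    then show "F (B xs # xs) = F (map (\<lambda>g. g xs) ?gs)"
      by simp
  qed
qed

lemma gr_rec:
  assumes "general_recursive n B" "general_recursive n G"
    and "general_recursive (Suc (Suc n)) (\<lambda>zs. H (zs ! 0) (zs ! 1) (tl (tl zs)))"
  shows "general_recursive n (\<lambda>xs. rec_nat (G xs) (\<lambda>y r. H y r xs) (B xs))"
  using gr_Cons[OF gr_primrec[OF assms(2,3)] assms(1)] by simp

text \<open>
  The minimization operator searches for a zero, and a truth value is \<open>0\<close> if it is false;
  therefore the search runs over the negated relation.
\<close>

lemma gr_Least:
  assumes "general_recursive (Suc n) (\<lambda>zs. of_bool (P (zs ! 0) (tl zs)))"
    and "\<And>xs. length xs = n \<Longrightarrow> \<exists>y. P y xs"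
  shows "general_recursive n (\<lambda>xs. LEAST y. P y xs)"
proof -
  have "general_recursive (Suc (Suc (Suc n))) (\<lambda>zs. 0)"
    by (rule gr_zero)
  \<comment> \<open>negation is a definition by cases, hence a primitive recursion with constant step\<close>
  from gr_rec[OF assms(1) gr_const[of "Suc n" 1] this]
  have "general_recursive (Suc n) (\<lambda>zs. of_bool (\<not> P (zs ! 0) (tl zs)))"
    by (rule gr_cong) auto
  from gr_mu[OF this] assms(2) show ?thesis
    by simp
qed

lemma gr_add:
  assumes "general_recursive n F" "general_recursive n G"
  shows "general_recursive n (\<lambda>xs. F xs + G xs)"
proof -
  have eq: "a + b = rec_nat a (\<lambda>_ r. Suc r) b" for a b :: nat
    by (induction b) auto
  show ?thesis
    unfolding eq by (intro gr_rec assms gr_Suc gr_proj) simp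
qed

lemma gr_mult:
  assumes "general_recursive n F" "general_recursive n G"
  shows "general_recursive n (\<lambda>xs. F xs * G xs)"
proof -
  have eq: "a * b = rec_nat 0 (\<lambda>_ r. r + a) b" for a b :: nat
    by (induction b) auto
  show ?thesis
    unfolding eq
    by (intro gr_rec[where H = "\<lambda>_ r xs. r + F xs"] assms gr_add gr_zero gr_proj gr_tl[OF gr_tl]) simp
qed

lemma gr_diff:
  assumes "general_recursive n F" "general_recursive n G"
  shows "general_recursive n (\<lambda>xs. F xs - G xs)"
proof -
  have pred: "a - Suc 0 = rec_nat 0 (\<lambda>y _. y) a" for a :: nat
    by (cases a) auto
  have gr_pred: "general_recursive m (\<lambda>xs. K xs - Suc 0)" if "general_recursive m K" for m K
    unfolding pred by (intro gr_rec that gr_zero gr_proj) simp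
  have eq: "a - b = rec_nat a (\<lambda>_ r. r - Suc 0) b" for a b :: nat
    by (induction b) auto
  have "general_recursive n (\<lambda>xs. rec_nat (F xs) (\<lambda>_ r. r - Suc 0) (G xs))"
    by (intro gr_rec assms gr_pred gr_proj) simp
  then show ?thesis
    by (rule gr_cong) (rule eq)
qed

lemma gr_le:
  assumes "general_recursive n F" "general_recursive n G"
  shows "general_recursive n (\<lambda>xs. of_bool (F xs \<le> G xs))"
  by (rule gr_cong[OF gr_diff[OF gr_const[of n 1] gr_diff[OF assms]]]) auto

lemma gr_not:
  assumes "general_recursive n (\<lambda>xs. of_bool (P xs))"
  shows "general_recursive n (\<lambda>xs. of_bool (\<not> P xs))"
  by (rule gr_cong[OF gr_diff[OF gr_const[of n 1] assms]]) auto

lemma gr_conj: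
  assumes "general_recursive n (\<lambda>xs. of_bool (P xs))" "general_recursive n (\<lambda>xs. of_bool (Q xs))"
  shows "general_recursive n (\<lambda>xs. of_bool (P xs \<and> Q xs))"
  by (rule gr_cong[OF gr_mult[OF assms]]) auto

lemma gr_imp:
  assumes "general_recursive n (\<lambda>xs. of_bool (P xs))" "general_recursive n (\<lambda>xs. of_bool (Q xs))"
  shows "general_recursive n (\<lambda>xs. of_bool (P xs \<longrightarrow> Q xs))"
  by (rule gr_cong[OF gr_not[OF gr_conj[OF assms(1) gr_not[OF assms(2)]]]]) auto

lemma gr_iff:
  assumes "general_recursive n (\<lambda>xs. of_bool (P xs))" "general_recursive n (\<lambda>xs. of_bool (Q xs))"
  shows "general_recursive n (\<lambda>xs. of_bool (P xs \<longleftrightarrow> Q xs))"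
  by (rule gr_cong[OF gr_conj[OF gr_imp[OF assms] gr_imp[OF assms(2,1)]]]) auto

lemma gr_less:
  assumes "general_recursive n F" "general_recursive n G"
  shows "general_recursive n (\<lambda>xs. of_bool (F xs < G xs))"
  by (rule gr_cong[OF gr_not[OF gr_le[OF assms(2,1)]]]) auto

lemma gr_eq:
  assumes "general_recursive n F" "general_recursive n G"
  shows "general_recursive n (\<lambda>xs. of_bool (F xs = G xs))"
  by (rule gr_cong[OF gr_conj[OF gr_le[OF assms] gr_le[OF assms(2,1)]]]) auto

lemma gr_if:
  assumes "general_recursive n (\<lambda>xs. of_bool (P xs))" "general_recursive n F" "general_recursive n G"
  shows "general_recursive n (\<lambda>xs. if P xs then F xs else G xs)"
  by (rule gr_cong[OF gr_add[OF gr_mult[OF assms(1,2)] gr_mult[OF gr_not[OF assms(1)] assms(3)]]]) auto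

abbreviation pfst :: "nat \<Rightarrow> nat" where "pfst z \<equiv> fst (prod_decode z)"
abbreviation psnd :: "nat \<Rightarrow> nat" where "psnd z \<equiv> snd (prod_decode z)"

lemma gr_triangle:
  assumes "general_recursive n F"
  shows "general_recursive n (\<lambda>xs. triangle (F xs))"
proof -
  have eq: "triangle a = rec_nat 0 (\<lambda>y r. r + Suc y) a" for a
    by (induction a) auto
  show ?thesis
    unfolding eq by (intro gr_rec assms gr_add gr_Suc gr_zero gr_proj) simp_all
qed

lemma gr_pair:
  assumes "general_recursive n F" "general_recursive n G"
  shows "general_recursive n (\<lambda>xs. prod_encode (F xs, G xs))"
  unfolding prod_encode_def split using assms by (intro gr_add gr_triangle)

text \<open>
  The pair \<open>(a, b)\<close> is coded by \<open>triangle (a + b) + a\<close>, which lies between the triangular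
  numbers with indices \<open>a + b\<close> and \<open>a + b + 1\<close>; so the sum \<open>a + b\<close> can be found by a search.
\<close>

lemma prod_decode_via_Least:
  defines "w z \<equiv> LEAST w. z < triangle (Suc w)"
  shows "pfst z = z - triangle (w z)" "psnd z = w z - pfst z"
proof -
  obtain a b where z: "z = prod_encode (a, b)"
    by (metis prod.exhaust prod_decode_inverse)
  have mono: "triangle i \<le> triangle j" if "i \<le> j" for i j
    using that by (induction rule: dec_induct) auto
  have "w z = a + b"
    unfolding w_def
  proof (rule Least_equality)
    show "z < triangle (Suc (a + b))"
      by (simp add: z prod_encode_def)
    fix w assume "z < triangle (Suc w)"
    then show "a + b \<le> w"
      using mono[of "Suc w" "a + b"] by (force simp: z prod_encode_def not_less_eq_eq)
  qed
  then show "pfst z = z - triangle (w z)" "psnd z = w z - pfst z"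
    by (simp_all add: z, simp add: prod_encode_def)
qed

lemma gr_triangle_root:
  assumes "general_recursive n F"
  shows "general_recursive n (\<lambda>xs. LEAST w. F xs < triangle (Suc w))"
proof (rule gr_Least)
  show "general_recursive (Suc n) (\<lambda>zs. of_bool (F (tl zs) < triangle (Suc (zs ! 0))))"
    by (intro gr_less gr_tl[OF assms] gr_triangle gr_Suc gr_proj) simp
  have "a < triangle (Suc a)" for a
    by (induction a) auto
  then show "\<exists>w. F xs < triangle (Suc w)" for xs
    by blast
qed

lemma gr_pfst: "general_recursive n F \<Longrightarrow> general_recursive n (\<lambda>xs. pfst (F xs))"
  unfolding prod_decode_via_Least(1) by (intro gr_diff gr_triangle gr_triangle_root)

lemma gr_psnd: "general_recursive n F \<Longrightarrow> general_recursive n (\<lambda>xs. psnd (F xs))"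
  unfolding prod_decode_via_Least(2) by (intro gr_diff gr_pfst gr_triangle_root)

lemma gr_half:
  assumes "general_recursive n F"
  shows "general_recursive n (\<lambda>xs. F xs div 2)"
proof -
  have eq: "a div 2 = rec_nat 0 (\<lambda>y r. y - r) a" for a :: nat
  proof (induction a)
    case (Suc a)
    have "Suc a div 2 = a - a div 2"
      by presburger
    with Suc show ?case
      by (metis old.nat.simps(7))
  qed simp
  show ?thesis
    unfolding eq by (intro gr_rec assms gr_diff gr_zero gr_proj) simp_all
qed

lemma gr_even:
  assumes "general_recursive n F"
  shows "general_recursive n (\<lambda>xs. of_bool (even (F xs)))"
proof -
  have "even a \<longleftrightarrow> a = a div 2 + a div 2" for a :: nat
    by presburger
  then show ?thesis
    using gr_eq[OF assms gr_add[OF gr_half[OF assms] gr_half[OF assms]]] by simp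
qed

lemmas gr_intros = gr_const gr_Suc gr_add gr_mult gr_diff gr_le gr_less gr_eq gr_not gr_conj gr_imp
  gr_iff gr_if gr_pair gr_pfst gr_psnd gr_half gr_even

section \<open>Computable rational-valued functions\<close>

text \<open>
  Values are represented as \<open>(a - b) / d\<close> with natural numbers \<open>a\<close>, \<open>b\<close> and \<open>d > 0\<close>, because
  this form makes arithmetic on values a matter of arithmetic on \<open>\<nat>\<close>. The lemmas
  \<open>rr_nat_to_rat_surj\<close> and \<open>rational_recursive_code\<close> convert it to and from codes of rationals.
\<close>

definition rational_recursive :: "nat \<Rightarrow> (nat list \<Rightarrow> rat) \<Rightarrow> bool" where
  "rational_recursive n F \<longleftrightarrow> (\<exists>a b d. general_recursive n a \<and> general_recursive n b \<and> general_recursive n d \<and>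
     (\<forall>xs. length xs = n \<longrightarrow> 0 < d xs \<and> F xs = (of_nat (a xs) - of_nat (b xs)) / of_nat (d xs)))"

lemma rational_recursiveI:
  assumes "general_recursive n a" "general_recursive n b" "general_recursive n d"
    and "\<And>xs. length xs = n \<Longrightarrow> 0 < d xs"
    and "\<And>xs. length xs = n \<Longrightarrow> F xs = (of_nat (a xs) - of_nat (b xs)) / of_nat (d xs)"
  shows "rational_recursive n F"
  using assms unfolding rational_recursive_def by blast

lemma int_decode_parts:
  "int_decode z = int (if even z then z div 2 else 0) - int (if even z then 0 else Suc (z div 2))"
  by (simp add: int_decode_def sum_decode_def)

lemma nat_to_rat_surj_quotient:
  "nat_to_rat_surj k = of_int (int_decode (pfst k)) / of_int (int_decode (psnd k))"
  by (simp add: nat_to_rat_surj_def Let_def split_beta Fract_of_int_quotient)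

text \<open>
  A code is a pair of codes of integers, of which an even one stands for a nonnegative and an
  odd one for a negative integer. If the denominator is negative, then the positive and the
  negative part of the numerator change places.
\<close>

lemma rr_nat_to_rat_surj:
  assumes "general_recursive n F"
  shows "rational_recursive n (\<lambda>xs. nat_to_rat_surj (F xs))"
proof (rule rational_recursiveI)
  define pos neg :: "nat \<Rightarrow> nat" where "pos z = (if even z then z div 2 else 0)"
    and "neg z = (if even z then 0 else Suc (z div 2))" for z
  have gr: "general_recursive m (\<lambda>xs. pos (K xs))" "general_recursive m (\<lambda>xs. neg (K xs))"
    if "general_recursive m K" for m K
    unfolding pos_def neg_def by (intro gr_intros that)+
  let ?a = "\<lambda>xs. if psnd (F xs) = 0 then 0 else
     if even (psnd (F xs)) then pos (pfst (F xs)) else neg (pfst (F xs))"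
  let ?b = "\<lambda>xs. if psnd (F xs) = 0 then 0 else
     if even (psnd (F xs)) then neg (pfst (F xs)) else pos (pfst (F xs))"
  let ?d = "\<lambda>xs. if psnd (F xs) = 0 then 1 else pos (psnd (F xs)) + neg (psnd (F xs))"
  show "general_recursive n ?a" "general_recursive n ?b" "general_recursive n ?d"
    by (intro gr_intros gr assms)+
  show "0 < ?d xs" for xs
    by (auto simp: pos_def neg_def elim: evenE)
  have dec: "int_decode z = int (pos z) - int (neg z)" for z
    by (simp add: int_decode_parts pos_def neg_def)
  have sgn: "neg z = 0" if "even z" for z
    using that by (simp add: neg_def)
  have sgn': "pos z = 0" "neg z \<noteq> 0" if "odd z" for z
    using that by (simp_all add: pos_def neg_def)
  have pos0: "pos z = 0 \<longleftrightarrow> z = 0" if "even z" for z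
    using that by (auto simp: pos_def elim: evenE)
  show "nat_to_rat_surj (F xs) = (of_nat (?a xs) - of_nat (?b xs)) / of_nat (?d xs)" for xs
  proof (cases "even (psnd (F xs))")
    case True
    then show ?thesis
      by (simp add: nat_to_rat_surj_quotient dec sgn pos0)
  next
    case False
    then have "psnd (F xs) \<noteq> 0"
      by (rule contrapos_nn) simp
    with False show ?thesis
      by (simp add: nat_to_rat_surj_quotient dec sgn' minus_divide_left)
  qed
qed

lemma rational_recursive_code:
  assumes "rational_recursive n F"
  obtains f where "general_recursive n f" "\<And>xs. length xs = n \<Longrightarrow> F xs = nat_to_rat_surj (f xs)"
proof -
  obtain a b d where gr: "general_recursive n a" "general_recursive n b" "general_recursive n d"
    and pos: "\<And>xs. length xs = n \<Longrightarrow> 0 < d xs"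
    and F: "\<And>xs. length xs = n \<Longrightarrow> F xs = (of_nat (a xs) - of_nat (b xs)) / of_nat (d xs)"
    using assms unfolding rational_recursive_def by metis
  define f where "f xs = prod_encode (if b xs \<le> a xs then 2 * (a xs - b xs) else Suc (2 * (b xs - a xs - 1)), 2 * d xs)" for xs
  show ?thesis
  proof (rule that)
    show "general_recursive n f"
      unfolding f_def by (intro gr_intros gr)
    show "F xs = nat_to_rat_surj (f xs)" if "length xs = n" for xs
      using pos[OF that]
      by (auto simp: F[OF that] f_def nat_to_rat_surj_quotient int_decode_def sum_decode_def of_nat_diff)
  qed
qed

lemma rr_cong: "rational_recursive n F \<Longrightarrow> (\<And>xs. length xs = n \<Longrightarrow> G xs = F xs) \<Longrightarrow> rational_recursive n G"
  unfolding rational_recursive_def by auto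

lemma rr_of_nat: "general_recursive n F \<Longrightarrow> rational_recursive n (\<lambda>xs. of_nat (F xs))"
  by (rule rational_recursiveI[where b = "\<lambda>_. 0" and d = "\<lambda>_. 1"]) (auto intro: gr_const)

lemma rr_zero: "rational_recursive n (\<lambda>xs. 0)"
  using rr_of_nat[OF gr_const[of n 0]] by simp

lemma rr_add:
  assumes "rational_recursive n F" "rational_recursive n G"
  shows "rational_recursive n (\<lambda>xs. F xs + G xs)"
proof -
  obtain a b d where 1: "general_recursive n a" "general_recursive n b" "general_recursive n d"
    "\<And>xs. length xs = n \<Longrightarrow> 0 < d xs"
    "\<And>xs. length xs = n \<Longrightarrow> F xs = (of_nat (a xs) - of_nat (b xs)) / of_nat (d xs)"
    using assms(1) unfolding rational_recursive_def by metis
  obtain a' b' d' where 2: "general_recursive n a'" "general_recursive n b'" "general_recursive n d'"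
    "\<And>xs. length xs = n \<Longrightarrow> 0 < d' xs"
    "\<And>xs. length xs = n \<Longrightarrow> G xs = (of_nat (a' xs) - of_nat (b' xs)) / of_nat (d' xs)"
    using assms(2) unfolding rational_recursive_def by metis
  show ?thesis
  proof (rule rational_recursiveI)
    show "general_recursive n (\<lambda>xs. a xs * d' xs + a' xs * d xs)"
      "general_recursive n (\<lambda>xs. b xs * d' xs + b' xs * d xs)" "general_recursive n (\<lambda>xs. d xs * d' xs)"
      by (intro gr_intros 1 2)+
  next
    fix xs :: "nat list" assume "length xs = n"
    then have "F xs = (of_nat (a xs) - of_nat (b xs)) / of_nat (d xs)"
      "G xs = (of_nat (a' xs) - of_nat (b' xs)) / of_nat (d' xs)" "0 < d xs" "0 < d' xs"
      using 1(4,5) 2(4,5) by blast+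
    then show "F xs + G xs = (of_nat (a xs * d' xs + a' xs * d xs) - of_nat (b xs * d' xs + b' xs * d xs)) / of_nat (d xs * d' xs)"
      by (simp add: add_frac_eq algebra_simps)
  qed (simp add: 1 2)
qed

lemma rr_uminus:
  assumes "rational_recursive n F"
  shows "rational_recursive n (\<lambda>xs. - F xs)"
proof -
  obtain a b d where 1: "general_recursive n a" "general_recursive n b" "general_recursive n d"
    "\<And>xs. length xs = n \<Longrightarrow> 0 < d xs"
    "\<And>xs. length xs = n \<Longrightarrow> F xs = (of_nat (a xs) - of_nat (b xs)) / of_nat (d xs)"
    using assms(1) unfolding rational_recursive_def by metis
  show ?thesis
    by (rule rational_recursiveI[OF 1(2,1,3,4)]) (simp_all add: 1(5) minus_divide_left)
qed

lemma rr_diff: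
  assumes "rational_recursive n F" "rational_recursive n G"
  shows "rational_recursive n (\<lambda>xs. F xs - G xs)"
  using rr_add[OF assms(1) rr_uminus[OF assms(2)]] by simp

lemma rr_abs:
  assumes "rational_recursive n F"
  shows "rational_recursive n (\<lambda>xs. \<bar>F xs\<bar>)"
proof -
  obtain a b d where 1: "general_recursive n a" "general_recursive n b" "general_recursive n d"
    "\<And>xs. length xs = n \<Longrightarrow> 0 < d xs"
    "\<And>xs. length xs = n \<Longrightarrow> F xs = (of_nat (a xs) - of_nat (b xs)) / of_nat (d xs)"
    using assms(1) unfolding rational_recursive_def by metis
  show ?thesis
  proof (rule rational_recursiveI)
    show "general_recursive n (\<lambda>xs. (a xs - b xs) + (b xs - a xs))" "general_recursive n (\<lambda>xs. 0)"
      by (intro gr_intros 1)+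
    show "\<bar>F xs\<bar> = (of_nat ((a xs - b xs) + (b xs - a xs)) - of_nat 0) / of_nat (d xs)" if "length xs = n" for xs
      using 1(4,5)[OF that] by (cases "b xs \<le> a xs") (auto simp: abs_divide of_nat_diff)
  qed (use 1 in auto)
qed

lemma rr_halve:
  assumes "rational_recursive n F"
  shows "rational_recursive n (\<lambda>xs. F xs / 2)"
proof -
  obtain a b d where 1: "general_recursive n a" "general_recursive n b" "general_recursive n d"
    "\<And>xs. length xs = n \<Longrightarrow> 0 < d xs"
    "\<And>xs. length xs = n \<Longrightarrow> F xs = (of_nat (a xs) - of_nat (b xs)) / of_nat (d xs)"
    using assms(1) unfolding rational_recursive_def by metis
  show ?thesis
    by (rule rational_recursiveI[OF 1(1,2) gr_mult[OF 1(3) gr_const[of n 2]]]) (auto simp: 1)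
qed

lemma rr_max:
  assumes "rational_recursive n F" "rational_recursive n G"
  shows "rational_recursive n (\<lambda>xs. max (F xs) (G xs))"
proof -
  have "max x y = (x + y + \<bar>x - y\<bar>) / 2" for x y :: rat
    by (simp add: max_def)
  then show ?thesis
    using rr_halve[OF rr_add[OF rr_add[OF assms] rr_abs[OF rr_diff[OF assms]]]] by presburger
qed

lemma rr_if:
  assumes "general_recursive n (\<lambda>xs. of_bool (P xs))" "rational_recursive n F" "rational_recursive n G"
  shows "rational_recursive n (\<lambda>xs. if P xs then F xs else G xs)"
proof -
  obtain f g where 1: "general_recursive n f" "\<And>xs. length xs = n \<Longrightarrow> F xs = nat_to_rat_surj (f xs)"
    "general_recursive n g" "\<And>xs. length xs = n \<Longrightarrow> G xs = nat_to_rat_surj (g xs)"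
    by (metis rational_recursive_code assms(2,3))
  show ?thesis
    by (rule rr_cong[OF rr_nat_to_rat_surj[OF gr_if[OF assms(1) 1(1,3)]]]) (simp add: 1)
qed

text \<open>
  Primitive recursion produces natural numbers, so the partial sums are carried along as codes
  of rationals.
\<close>

lemma rr_sum:
  assumes "general_recursive n B" "rational_recursive (Suc n) (\<lambda>zs. F (zs ! 0) (tl zs))"
  shows "rational_recursive n (\<lambda>xs. \<Sum>i<B xs. F i xs)"
proof -
  obtain f where f: "general_recursive (Suc n) f"
    "\<And>zs. length zs = Suc n \<Longrightarrow> F (zs ! 0) (tl zs) = nat_to_rat_surj (f zs)"
    using rational_recursive_code[OF assms(2)] by metis
  obtain add where add: "general_recursive 2 add"
    "\<And>zs. length zs = 2 \<Longrightarrow> nat_to_rat_surj (zs ! 0) + nat_to_rat_surj (zs ! 1) = nat_to_rat_surj (add zs)"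
    by (rule rational_recursive_code[OF rr_add[OF rr_nat_to_rat_surj rr_nat_to_rat_surj]])
      (rule gr_proj[of 0 2], simp, rule gr_proj[of 1 2], simp, blast)
  obtain z where z: "nat_to_rat_surj z = 0"
    by (metis surj_nat_to_rat_surj surjD)
  define s where "s xs = rec_nat z (\<lambda>i r. add [r, f (i # xs)]) (B xs)" for xs
  have "general_recursive n s"
    unfolding s_def
  proof (rule gr_rec[OF assms(1) gr_const])
    let ?gs = "[\<lambda>zs. zs ! 1, \<lambda>zs. f (zs ! 0 # tl (tl zs))]"
    let ?hs = "(\<lambda>zs. zs ! 0) # map (\<lambda>i zs. zs ! Suc (Suc i)) [0..<n]"
    have "general_recursive (Suc (Suc n)) (\<lambda>zs. f (map (\<lambda>h. h zs) ?hs))"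
      using f(1) by (intro gr_comp) (auto intro: gr_proj)
    then have f': "general_recursive (Suc (Suc n)) (\<lambda>zs. f (zs ! 0 # tl (tl zs)))"
    proof (rule gr_cong)
      fix zs :: "nat list" assume "length zs = Suc (Suc n)"
      then have "map (\<lambda>h. h zs) ?hs = zs ! 0 # tl (tl zs)"
        by (auto intro!: nth_equalityI simp: nth_Cons nth_tl split: nat.splits)
      then show "f (zs ! 0 # tl (tl zs)) = f (map (\<lambda>h. h zs) ?hs)"
        by simp
    qed
    have "general_recursive (Suc (Suc n)) (\<lambda>zs. add (map (\<lambda>g. g zs) ?gs))"
      by (rule gr_comp) (use add(1) f' in \<open>auto intro: gr_proj simp: numeral_2_eq_2\<close>)
    then show "general_recursive (Suc (Suc n)) (\<lambda>zs. add [zs ! 1, f (zs ! 0 # tl (tl zs))])"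
      by simp
  qed
  then show ?thesis
  proof (rule rr_cong[OF rr_nat_to_rat_surj])
    fix xs :: "nat list" assume len: "length xs = n"
    have "(\<Sum>i<k. F i xs) = nat_to_rat_surj (rec_nat z (\<lambda>i r. add [r, f (i # xs)]) k)" for k
      using z add(2)[of "[_, _]"] f(2)[of "_ # xs"] by (induction k) (simp_all add: len)
    then show "(\<Sum>i<B xs. F i xs) = nat_to_rat_surj (s xs)"
      by (simp add: s_def)
  qed
qed

section \<open>The tree of finite sequences\<close>

text \<open>
  The nodes are all natural numbers: \<open>0\<close> is the root, the empty sequence, and \<open>child i s\<close>
  extends the sequence \<open>s\<close> by the last entry \<open>i\<close>. So \<open>s\<close> is the code of the reversed sequence in
  the sense of \<^const>\<open>list_encode\<close>. At the root, \<open>parent\<close> and \<open>label\<close> take the value \<open>0\<close>, since \<open>0\<close>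
  codes the pair \<open>(0, 0)\<close>.
\<close>

definition child :: "nat \<Rightarrow> nat \<Rightarrow> nat" where
  "child i s = Suc (prod_encode (i, s))"

definition parent :: "nat \<Rightarrow> nat" where
  "parent t = psnd (t - 1)"

definition label :: "nat \<Rightarrow> nat" where
  "label t = pfst (t - 1)"

primrec branch :: "(nat \<Rightarrow> nat) \<Rightarrow> nat \<Rightarrow> nat" where
  "branch \<beta> 0 = 0"
| "branch \<beta> (Suc m) = child (\<beta> m) (branch \<beta> m)"

definition depth :: "nat \<Rightarrow> nat" where
  "depth t = (LEAST j. (parent ^^ j) t = 0)"

lemma parent_child [simp]: "parent (child i s) = s"
  and label_child [simp]: "label (child i s) = i"
  and child_neq_0 [simp]: "child i s \<noteq> 0"
  by (simp_all add: parent_def label_def child_def)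

lemma child_label_parent: "t \<noteq> 0 \<Longrightarrow> child (label t) (parent t) = t"
  by (simp add: child_def label_def parent_def)

lemma parent_less: "t \<noteq> 0 \<Longrightarrow> parent t < t"
  using le_prod_encode_2[of "parent t" "label t"]
  by (subst (2) child_label_parent[symmetric]) (simp_all add: child_def)

lemma prod_decode_0: "prod_decode 0 = (0, 0)"
  using prod_encode_inverse[of "(0, 0)"] by (simp add: prod_encode_def)

lemma parent_0 [simp]: "parent 0 = 0" and label_0 [simp]: "label 0 = 0"
  by (simp_all add: parent_def label_def prod_decode_0)

lemma ancestor_branch: "j \<le> m \<Longrightarrow> (parent ^^ j) (branch \<beta> m) = branch \<beta> (m - j)"
proof (induction j)
  case (Suc j)
  then obtain k where "m - j = Suc k"
    by (metis Suc_diff_Suc Suc_le_lessD)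
  moreover from this have "m - Suc j = k"
    by simp
  ultimately show ?case
    using Suc by simp
qed simp

lemma branch_eq_0_iff: "branch \<beta> m = 0 \<longleftrightarrow> m = 0"
  by (cases m) simp_all

lemma depth_branch: "depth (branch \<beta> m) = m"
  unfolding depth_def
proof (rule Least_equality)
  show "(parent ^^ m) (branch \<beta> m) = 0"
    by (simp add: ancestor_branch)
  fix j assume "(parent ^^ j) (branch \<beta> m) = 0"
  then show "m \<le> j"
    using ancestor_branch[of j m \<beta>] by (cases "j \<le> m") (simp_all add: branch_eq_0_iff)
qed

lemma gr_parent: "general_recursive n F \<Longrightarrow> general_recursive n (\<lambda>xs. parent (F xs))"
  and gr_label: "general_recursive n F \<Longrightarrow> general_recursive n (\<lambda>xs. label (F xs))"
  unfolding parent_def label_def by (intro gr_intros; assumption)+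

lemma gr_ancestor:
  assumes "general_recursive n J" "general_recursive n F"
  shows "general_recursive n (\<lambda>xs. (parent ^^ J xs) (F xs))"
proof -
  have eq: "(parent ^^ j) t = rec_nat t (\<lambda>_ r. parent r) j" for j t
    by (induction j) auto
  show ?thesis
    unfolding eq by (intro gr_rec assms gr_parent gr_proj) simp
qed

lemma gr_depth:
  assumes "general_recursive n F"
  shows "general_recursive n (\<lambda>xs. depth (F xs))"
  unfolding depth_def
proof (rule gr_Least)
  show "general_recursive (Suc n) (\<lambda>zs. of_bool ((parent ^^ (zs ! 0)) (F (tl zs)) = 0))"
    by (intro gr_intros gr_ancestor gr_tl[OF assms] gr_proj) simp
  have "\<exists>j. (parent ^^ j) t = 0" for t
  proof (induction t rule: less_induct)
    case (less t)
    show ?case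
    proof (cases "t = 0")
      case True
      then show ?thesis
        by (intro exI[of _ 0]) simp
    next
      case False
      then obtain j where "(parent ^^ j) (parent t) = 0"
        using less parent_less by blast
      then show ?thesis
        by (intro exI[of _ "Suc j"]) (simp add: funpow_swap1)
    qed
  qed
  then show "\<exists>j. (parent ^^ j) (F xs) = 0" for xs .
qed

text \<open>
  The sequence \<open>t\<close> as a finite approximation of an oracle: the answer to the query \<open>q\<close> is \<open>0\<close> if
  \<open>t\<close> is too short to determine it, and the successor of entry number \<open>q\<close> otherwise.
\<close>

definition known :: "nat \<Rightarrow> nat \<Rightarrow> nat" where
  "known t q = (if q < depth t then Suc (label ((parent ^^ (depth t - Suc q)) t)) else 0)"

lemma known_branch: "known (branch \<beta> m) q = (if q < m then Suc (\<beta> q) else 0)"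
proof (cases "q < m")
  case True
  then have "m - (m - Suc q) = Suc q"
    by simp
  with True show ?thesis
    by (simp add: known_def depth_branch ancestor_branch)
qed (simp add: known_def depth_branch)

lemma gr_known:
  assumes "general_recursive n F" "general_recursive n G"
  shows "general_recursive n (\<lambda>xs. known (F xs) (G xs))"
  unfolding known_def by (intro gr_intros gr_depth gr_label gr_ancestor assms)

section \<open>Membership in a \<open>\<Sigma>\<^sup>1\<^sub>1\<close> set as existence of an infinite branch\<close>

text \<open>
  In general no finite part of \<open>X\<close> shows that \<open>X\<close> does not satisfy an arithmetical formula \<open>\<phi>\<close>.
  Therefore a branch codes not only \<open>X\<close>, but a table that also contains the truth values of all
  subformulas of \<open>\<phi>\<close> under all assignments, with a witness for each true existential statement.
  Such a table is correct if and only if it meets a list of conditions, each of which concerns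
  only finitely many entries. So an incorrect table is recognized from a finite part, and the
  tree cuts it off there.

  The index of a subformula in the table is its number under \<^const>\<open>to_nat\<close>. Since \<open>\<phi>\<close> is fixed, only
  finitely many of these constants occur.
\<close>

instance arith_term :: countable by countable_datatype
instance arith_formula :: countable by countable_datatype

text \<open>
  Assignments are coded in such a way that an update of one variable is computable, and that a
  number \<open>n\<close> as the value of all the variables has a code. The pairing function turns every
  number into an infinite sequence (\<open>entry\<close>) that \<open>set_entry\<close> changes at one place, and all
  entries of \<open>0\<close> are \<open>0\<close>. The code \<open>c\<close> of an assignment is a pair: its first component is the
  default value, and entry number \<open>v\<close> of the second component is \<open>0\<close> if the variable \<open>v\<close> has the
  default value, and the successor of its value otherwise.
\<close>

primrec entry :: "nat \<Rightarrow> nat \<Rightarrow> nat" where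
  "entry l 0 = pfst l"
| "entry l (Suc v) = entry (psnd l) v"

primrec set_entry :: "nat \<Rightarrow> nat \<Rightarrow> nat \<Rightarrow> nat" where
  "set_entry 0 a l = prod_encode (a, psnd l)"
| "set_entry (Suc v) a l = prod_encode (pfst l, set_entry v a (psnd l))"

lemma entry_set_entry: "entry (set_entry v a l) w = (if w = v then a else entry l w)"
  by (induction v arbitrary: w l; case_tac w) auto

lemma entry_0 [simp]: "entry 0 v = 0"
  by (induction v) (simp_all add: prod_decode_0)

definition env :: "nat \<Rightarrow> nat \<Rightarrow> nat" where
  "env c v = (if entry (psnd c) v = 0 then pfst c else entry (psnd c) v - 1)"

definition env_upd :: "nat \<Rightarrow> nat \<Rightarrow> nat \<Rightarrow> nat" where
  "env_upd v a c = prod_encode (pfst c, set_entry v (Suc a) (psnd c))"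

lemma env_env_upd [simp]: "env (env_upd v a c) = (env c)(v := a)"
  by (auto simp: env_def env_upd_def entry_set_entry)

lemma env_const [simp]: "env (prod_encode (n, 0)) = (\<lambda>_. n)"
  by (auto simp: env_def)

lemma gr_entry: "general_recursive n F \<Longrightarrow> general_recursive n (\<lambda>xs. entry (F xs) v)"
  by (induction v arbitrary: F) (simp_all add: gr_pfst gr_psnd)

lemma gr_set_entry:
  "general_recursive n A \<Longrightarrow> general_recursive n F \<Longrightarrow> general_recursive n (\<lambda>xs. set_entry v (A xs) (F xs))"
  by (induction v arbitrary: F) (simp_all add: gr_pair gr_pfst gr_psnd)

lemma gr_env_upd:
  "general_recursive n A \<Longrightarrow> general_recursive n F \<Longrightarrow> general_recursive n (\<lambda>xs. env_upd v (A xs) (F xs))"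
  unfolding env_upd_def by (intro gr_intros gr_set_entry)

lemma gr_term_val: "general_recursive n F \<Longrightarrow> general_recursive n (\<lambda>xs. term_val (env (F xs)) t)"
proof (induction t)
  case (Var v)
  then show ?case
    unfolding env_def term_val.simps by (intro gr_intros gr_entry)
qed (simp_all add: gr_const gr_Suc gr_add gr_mult)

text \<open>
  At the key \<open>formula_key \<phi> c\<close> the table holds \<open>0\<close> if \<open>\<phi>\<close> is false under the assignment \<open>c\<close>, and
  a positive number if it is true, namely the successor of a witness if \<open>\<phi>\<close> is existential. At
  the key \<open>set_key i a\<close> it holds a positive number if and only if \<open>a\<close> belongs to the set
  variable \<open>i\<close>.
\<close>

definition formula_key :: "arith_formula \<Rightarrow> nat \<Rightarrow> nat" where
  "formula_key \<phi> c = prod_encode (Suc (to_nat \<phi>), c)"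

definition set_key :: "nat \<Rightarrow> nat \<Rightarrow> nat" where
  "set_key i a = prod_encode (0, prod_encode (i, a))"

text \<open>
  The conditions on the table that concern the subformulas of the last argument under the
  assignment \<open>c\<close>. Entries are read through \<open>L\<close>, which returns \<open>0\<close> for an unknown entry and the
  successor of the entry otherwise: \<open>1\<close> means false, a value above \<open>1\<close> means true, and \<open>L - 2\<close>
  is the witness. A condition with an unknown entry counts as satisfied. An existential formula
  has infinitely many instances, and \<open>a\<close> selects the one that is tested.
\<close>

primrec consistent :: "(nat \<Rightarrow> nat) \<Rightarrow> nat \<Rightarrow> nat \<Rightarrow> arith_formula \<Rightarrow> bool" where
  "consistent L c a (Eq s t) \<longleftrightarrow> (L (formula_key (Eq s t) c) \<noteq> 0 \<longrightarrow>
     (1 < L (formula_key (Eq s t) c) \<longleftrightarrow> term_val (env c) s = term_val (env c) t))"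
| "consistent L c a (Less s t) \<longleftrightarrow> (L (formula_key (Less s t) c) \<noteq> 0 \<longrightarrow>
     (1 < L (formula_key (Less s t) c) \<longleftrightarrow> term_val (env c) s < term_val (env c) t))"
| "consistent L c a (Mem t i) \<longleftrightarrow>
     (L (formula_key (Mem t i) c) \<noteq> 0 \<and> L (set_key i (term_val (env c) t)) \<noteq> 0 \<longrightarrow>
     (1 < L (formula_key (Mem t i) c) \<longleftrightarrow> 1 < L (set_key i (term_val (env c) t))))"
| "consistent L c a (Neg \<phi>) \<longleftrightarrow>
     (L (formula_key (Neg \<phi>) c) \<noteq> 0 \<and> L (formula_key \<phi> c) \<noteq> 0 \<longrightarrow>
     (1 < L (formula_key (Neg \<phi>) c) \<longleftrightarrow> \<not> 1 < L (formula_key \<phi> c))) \<and> consistent L c a \<phi>"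
| "consistent L c a (Conj \<phi> \<psi>) \<longleftrightarrow>
     (L (formula_key (Conj \<phi> \<psi>) c) \<noteq> 0 \<and> L (formula_key \<phi> c) \<noteq> 0 \<and> L (formula_key \<psi> c) \<noteq> 0 \<longrightarrow>
     (1 < L (formula_key (Conj \<phi> \<psi>) c) \<longleftrightarrow> 1 < L (formula_key \<phi> c) \<and> 1 < L (formula_key \<psi> c))) \<and>
     consistent L c a \<phi> \<and> consistent L c a \<psi>"
| "consistent L c a (Exists v \<phi>) \<longleftrightarrow>
     (1 < L (formula_key (Exists v \<phi>) c) \<longrightarrow>
       L (formula_key \<phi> (env_upd v (L (formula_key (Exists v \<phi>) c) - 2) c)) \<noteq> 1) \<and>
     (L (formula_key (Exists v \<phi>) c) = 1 \<longrightarrow> L (formula_key \<phi> (env_upd v a c)) \<le> 1) \<and>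
     consistent L c a \<phi>"

lemma gr_consistent:
  assumes gr: "general_recursive n T" "general_recursive n C" "general_recursive n A"
  shows "general_recursive n (\<lambda>xs. of_bool (consistent (known (T xs)) (C xs) (A xs) \<phi>))"
proof (induction \<phi>)
  case (Neg \<phi>)
  show ?case
    unfolding consistent.simps formula_key_def
    by (intro gr_intros gr_known gr Neg)
next
  case (Conj \<phi> \<psi>)
  show ?case
    unfolding consistent.simps formula_key_def
    by (intro gr_intros gr_known gr Conj)
next
  case (Exists v \<phi>)
  show ?case
    unfolding consistent.simps formula_key_def
    by (intro gr_intros gr_known gr_env_upd gr Exists)
qed (unfold consistent.simps formula_key_def set_key_def, (intro gr_intros gr_known gr_term_val gr)+)

lemma consistent_sound:
  assumes "\<And>c a. consistent (\<lambda>q. Suc (W q)) c a \<phi>"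
  shows "0 < W (formula_key \<phi> c) \<longleftrightarrow> holds (\<lambda>i. {a. 0 < W (set_key i a)}) (env c) \<phi>"
  using assms
proof (induction \<phi> arbitrary: c)
  case (Exists v \<phi>)
  have "consistent (\<lambda>q. Suc (W q)) c a \<phi>" for c a
    using Exists.prems[of c a] by simp
  then have IH: "0 < W (formula_key \<phi> (env_upd v a c)) \<longleftrightarrow>
      holds (\<lambda>i. {a. 0 < W (set_key i a)}) ((env c)(v := a)) \<phi>" for a
    using Exists.IH[of "env_upd v a c"] by (simp only: env_env_upd)
  let ?u = "W (formula_key (Exists v \<phi>) c)"
  have 1: "0 < W (formula_key \<phi> (env_upd v (?u - 1) c))" if "0 < ?u"
    using Exists.prems[of c 0] that by simp
  have 2: "W (formula_key \<phi> (env_upd v a c)) = 0" if "?u = 0" for a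
    using Exists.prems[of c a] that by simp
  show ?case
    using 1 2 IH by (metis holds.simps(6) not_gr_zero)
next
  case (Conj \<phi> \<psi>)
  then show ?case
    by simp
next
  case (Neg \<phi>)
  then have "0 < W (formula_key \<phi> c) \<longleftrightarrow> holds (\<lambda>i. {a. 0 < W (set_key i a)}) (env c) \<phi>"
    by simp
  with Neg.prems[of c] show ?case
    by auto
qed simp_all

text \<open>
  Forgetting entries of a correct table cannot violate a condition. This is why a correct table
  is a branch of the tree of finite approximations.
\<close>

lemma consistent_mono:
  assumes "consistent L c a \<phi>" "\<And>q. L' q = 0 \<or> L' q = L q"
  shows "consistent L' c a \<phi>"
  using assms(1)
proof (induction \<phi>)
  case (Exists v \<phi>)
  let ?k = "formula_key (Exists v \<phi>) c"
  have "1 < L' ?k \<longrightarrow> L' (formula_key \<phi> (env_upd v (L' ?k - 2) c)) \<noteq> 1"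
    using Exists.prems assms(2)[of ?k] assms(2)[of "formula_key \<phi> (env_upd v (L' ?k - 2) c)"] by auto
  moreover have "L' ?k = 1 \<longrightarrow> L' (formula_key \<phi> (env_upd v a c)) \<le> 1"
    using Exists.prems assms(2)[of ?k] assms(2)[of "formula_key \<phi> (env_upd v a c)"] by auto
  ultimately show ?case
    using Exists by simp
next
  case (Eq s t)
  then show ?case
    using assms(2)[of "formula_key (Eq s t) c"] by auto
next
  case (Less s t)
  then show ?case
    using assms(2)[of "formula_key (Less s t) c"] by auto
next
  case (Mem t i)
  then show ?case
    using assms(2)[of "formula_key (Mem t i) c"] assms(2)[of "set_key i (term_val (env c) t)"] by auto
next
  case (Neg \<phi>)
  then show ?case
    using assms(2)[of "formula_key (Neg \<phi>) c"] assms(2)[of "formula_key \<phi> c"] by auto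
next
  case (Conj \<phi> \<psi>)
  then show ?case
    using assms(2)[of "formula_key (Conj \<phi> \<psi>) c"] assms(2)[of "formula_key \<phi> c"]
      assms(2)[of "formula_key \<psi> c"] by auto
qed

text \<open>
  Each condition looks at finitely many entries, so a sufficiently long part of a branch decides
  it in the same way as the whole branch. Therefore an infinite branch is a correct table.
\<close>

lemma consistent_eventually:
  assumes "\<And>q. eventually (\<lambda>m. L m q = L' q) F"
  shows "eventually (\<lambda>m. consistent (L m) c a \<phi> = consistent L' c a \<phi>) F"
proof (induction \<phi>)
  case (Exists v \<phi>)
  show ?case
    using Exists assms[of "formula_key (Exists v \<phi>) c"] assms[of "formula_key \<phi> (env_upd v a c)"]
      assms[of "formula_key \<phi> (env_upd v (L' (formula_key (Exists v \<phi>) c) - 2) c)"]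
    by eventually_elim simp
next
  case (Eq s t)
  show ?case
    using assms[of "formula_key (Eq s t) c"] by eventually_elim simp
next
  case (Less s t)
  show ?case
    using assms[of "formula_key (Less s t) c"] by eventually_elim simp
next
  case (Mem t i)
  show ?case
    using assms[of "formula_key (Mem t i) c"] assms[of "set_key i (term_val (env c) t)"]
    by eventually_elim simp
next
  case (Neg \<phi>)
  show ?case
    using Neg assms[of "formula_key (Neg \<phi>) c"] assms[of "formula_key \<phi> c"] by eventually_elim simp
next
  case (Conj \<phi> \<psi>)
  show ?case
    using Conj assms[of "formula_key (Conj \<phi> \<psi>) c"] assms[of "formula_key \<phi> c"]
      assms[of "formula_key \<psi> c"] by eventually_elim simp
qed

definition witness :: "(nat \<Rightarrow> nat set) \<Rightarrow> (nat \<Rightarrow> nat) \<Rightarrow> arith_formula \<Rightarrow> nat" where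
  "witness X e \<phi> = (if \<not> holds X e \<phi> then 0 else
     case \<phi> of Exists v \<psi> \<Rightarrow> Suc (SOME a. holds X (e(v := a)) \<psi>) | _ \<Rightarrow> 1)"

lemma witness_pos: "0 < witness X e \<phi> \<longleftrightarrow> holds X e \<phi>"
  by (auto simp: witness_def split: arith_formula.splits)

definition truth_table :: "(nat \<Rightarrow> nat set) \<Rightarrow> nat \<Rightarrow> nat" where
  "truth_table X q = (case pfst q of
     0 \<Rightarrow> of_bool (psnd (psnd q) \<in> X (pfst (psnd q)))
   | Suc k \<Rightarrow> witness X (env (psnd q)) (from_nat k))"

lemma truth_table_keys [simp]:
  "truth_table X (set_key i a) = of_bool (a \<in> X i)"
  "truth_table X (formula_key \<phi> c) = witness X (env c) \<phi>"
  by (simp_all add: truth_table_def set_key_def formula_key_def)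

lemma consistent_truth_table: "consistent (\<lambda>q. Suc (truth_table X q)) c a \<phi>"
proof (induction \<phi>)
  case (Exists v \<phi>)
  have "holds X ((env c)(v := witness X (env c) (Exists v \<phi>) - 1)) \<phi>" if "holds X (env c) (Exists v \<phi>)"
    using that by (simp add: witness_def) (rule someI_ex)
  then show ?case
    using Exists witness_pos[of X "env c" "Exists v \<phi>"] witness_pos[of X _ \<phi>]
    by (auto simp: not_less)
qed (auto simp: witness_pos)

text \<open>
  A node tests a single condition, which depends on its depth. Reading the depth as a pair makes
  every condition, itself coded by a pair \<open>(c, a)\<close>, occur at arbitrarily large depths and so
  also when all its entries are known. The second conjunct asks that \<open>\<phi>\<close> is not recorded as
  false when all variables have the value \<open>n\<close>.
\<close>

definition admissible :: "arith_formula \<Rightarrow> nat \<Rightarrow> nat \<Rightarrow> bool" where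
  "admissible \<phi> n t \<longleftrightarrow>
     consistent (known t) (pfst (pfst (depth t))) (psnd (pfst (depth t))) \<phi> \<and>
     known t (formula_key \<phi> (prod_encode (n, 0))) \<noteq> 1"

lemma gr_admissible:
  assumes "general_recursive k F" "general_recursive k G"
  shows "general_recursive k (\<lambda>xs. of_bool (admissible \<phi> (F xs) (G xs)))"
  unfolding admissible_def formula_key_def
  by (intro gr_intros gr_consistent gr_known gr_depth assms)

lemma admissible_branch_iff:
  "(\<exists>\<beta>. \<forall>m. admissible \<phi> n (branch \<beta> m)) \<longleftrightarrow> (\<exists>X. holds X (\<lambda>_. n) \<phi>)"
proof
  assume "\<exists>\<beta>. \<forall>m. admissible \<phi> n (branch \<beta> m)"
  then obtain \<beta> where \<beta>: "\<And>m. admissible \<phi> n (branch \<beta> m)"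
    by blast
  have ev: "\<forall>\<^sub>F m in sequentially. known (branch \<beta> m) q = Suc (\<beta> q)" for q
    using eventually_gt_at_top[of q] by eventually_elim (simp add: known_branch)
  have "consistent (\<lambda>q. Suc (\<beta> q)) c a \<phi>" for c a
  proof -
    obtain M where M: "\<And>m. M \<le> m \<Longrightarrow> consistent (known (branch \<beta> m)) c a \<phi> = consistent (\<lambda>q. Suc (\<beta> q)) c a \<phi>"
      using consistent_eventually[where L' = "\<lambda>q. Suc (\<beta> q)" and c = c and a = a and \<phi> = \<phi>, OF ev]
      by (auto simp: eventually_sequentially)
    \<comment> \<open>a depth at least \<open>M\<close> at which the condition for \<open>c\<close> and \<open>a\<close> is tested\<close>
    define m where "m = prod_encode (prod_encode (c, a), M)"
    have "consistent (known (branch \<beta> m)) c a \<phi>"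
      using \<beta>[of m] by (simp add: admissible_def depth_branch m_def)
    then show ?thesis
      using M[of m] le_prod_encode_2 by (simp add: m_def)
  qed
  note sound = consistent_sound[OF this, of "prod_encode (n, 0)"]
  let ?q = "formula_key \<phi> (prod_encode (n, 0))"
  have "known (branch \<beta> (Suc ?q)) ?q \<noteq> 1"
    using \<beta> unfolding admissible_def by blast
  then have "0 < \<beta> ?q"
    by (simp add: known_branch del: branch.simps)
  with sound show "\<exists>X. holds X (\<lambda>_. n) \<phi>"
    by auto
next
  assume "\<exists>X. holds X (\<lambda>_. n) \<phi>"
  then obtain X where X: "holds X (\<lambda>_. n) \<phi>" ..
  have "admissible \<phi> n (branch (truth_table X) m)" for m
    unfolding admissible_def
  proof
    show "consistent (known (branch (truth_table X) m)) c a \<phi>" for c a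
      by (rule consistent_mono[OF consistent_truth_table[of X]]) (simp add: known_branch)
    show "known (branch (truth_table X) m) (formula_key \<phi> (prod_encode (n, 0))) \<noteq> 1"
      using X witness_pos[of X "\<lambda>_. n" \<phi>] by (simp add: known_branch)
  qed
  then show "\<exists>\<beta>. \<forall>m. admissible \<phi> n (branch \<beta> m)"
    by blast
qed

lemma Sigma11_normal_form:
  assumes "Sigma11 C"
  obtains T where "\<And>k F G. general_recursive k F \<Longrightarrow> general_recursive k G \<Longrightarrow>
      general_recursive k (\<lambda>xs. of_bool (T (F xs) (G xs)))"
    and "\<And>n. n \<in> C \<longleftrightarrow> (\<exists>\<beta>. \<forall>m. T n (branch \<beta> m))"
proof -
  obtain \<phi> where "\<And>n. n \<in> C \<longleftrightarrow> (\<exists>X. holds X (\<lambda>_. n) \<phi>)"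
    using assms unfolding Sigma11_def by blast
  then show ?thesis
    by (intro that[of "admissible \<phi>"] gr_admissible) (simp_all add: admissible_branch_iff)
qed

section \<open>The norm of a tree\<close>

text \<open>
  For a function \<open>y\<close> that vanishes from \<open>B\<close> on, the sums over all nodes may be restricted to
  nodes below \<open>B\<close>. The bound is a parameter in order that several vectors can be treated with a
  common bound, and that the code of a vector can be used as a bound in the computation.
\<close>

definition inflow :: "nat \<Rightarrow> (nat \<Rightarrow> rat) \<Rightarrow> nat \<Rightarrow> rat" where
  "inflow B y s = (\<Sum>t<B. if t \<noteq> 0 \<and> parent t = s then y t else 0)"

definition defect :: "(nat \<Rightarrow> bool) \<Rightarrow> nat \<Rightarrow> (nat \<Rightarrow> rat) \<Rightarrow> rat" where
  "defect T B y = (\<Sum>s<B. \<bar>y s / 2 - inflow B y s\<bar> + (if T s then 0 else \<bar>y s\<bar>))"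

definition gauge_upto :: "(nat \<Rightarrow> bool) \<Rightarrow> nat \<Rightarrow> rat \<Rightarrow> rat \<Rightarrow> (nat \<Rightarrow> rat) \<Rightarrow> rat" where
  "gauge_upto T B x\<^sub>0 x\<^sub>1 y =
     max (max \<bar>x\<^sub>0\<bar> \<bar>x\<^sub>1\<bar>)
       (max (\<Sum>j<B. \<bar>y j\<bar>)
         (max \<bar>x\<^sub>0 + x\<^sub>1 + (\<Sum>j<B. y j)\<bar>
           (\<bar>x\<^sub>0 - x\<^sub>1\<bar> / 2 + defect T B y)))"

definition tail :: "N \<Rightarrow> nat \<Rightarrow> rat" where
  "tail v j = Poly_Mapping.lookup v (Suc (Suc j))"

definition tree_norm :: "(nat \<Rightarrow> bool) \<Rightarrow> N \<Rightarrow> rat" where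
  "tree_norm T v = gauge_upto T (Poly_Mapping.degree v)
     (Poly_Mapping.lookup v 0) (Poly_Mapping.lookup v 1) (tail v)"

lemma inflow_add: "inflow B (\<lambda>j. y j + z j) s = inflow B y s + inflow B z s"
  by (auto simp: inflow_def sum.distrib[symmetric] intro!: sum.cong)

lemma inflow_scale: "inflow B (\<lambda>j. q * y j) s = q * inflow B y s"
  by (auto simp: inflow_def sum_distrib_left intro!: sum.cong)

lemma defect_add: "defect T B (\<lambda>j. y j + z j) \<le> defect T B y + defect T B z"
proof -
  have combine: "a + a' \<le> (b + b') + (c + c')" if "a \<le> b + c" "a' \<le> b' + c'" for a a' b b' c c' :: rat
    using that by linarith
  have "\<bar>(y s + z s) / 2 - (inflow B y s + inflow B z s)\<bar> \<le>
      \<bar>y s / 2 - inflow B y s\<bar> + \<bar>z s / 2 - inflow B z s\<bar>" for s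
    using abs_triangle_ineq[of "y s / 2 - inflow B y s" "z s / 2 - inflow B z s"]
    by (simp add: add_divide_distrib algebra_simps)
  moreover have "(if T s then 0 else \<bar>y s + z s\<bar>) \<le> (if T s then 0 else \<bar>y s\<bar>) + (if T s then 0 else \<bar>z s\<bar>)" for s
    by (simp add: abs_triangle_ineq)
  ultimately have "\<bar>(y s + z s) / 2 - (inflow B y s + inflow B z s)\<bar> + (if T s then 0 else \<bar>y s + z s\<bar>) \<le>
      (\<bar>y s / 2 - inflow B y s\<bar> + (if T s then 0 else \<bar>y s\<bar>)) +
      (\<bar>z s / 2 - inflow B z s\<bar> + (if T s then 0 else \<bar>z s\<bar>))" for s
    by (rule combine)
  then show ?thesis
    unfolding defect_def inflow_add sum.distrib[symmetric] by (intro sum_mono)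
qed

lemma defect_scale: "defect T B (\<lambda>j. q * y j) = \<bar>q\<bar> * defect T B y"
proof -
  have "\<bar>q * y s / 2 - q * inflow B y s\<bar> = \<bar>q\<bar> * \<bar>y s / 2 - inflow B y s\<bar>" for s
    by (simp add: abs_mult[symmetric] algebra_simps)
  then show ?thesis
    by (auto simp: defect_def inflow_scale sum_distrib_left abs_mult algebra_simps intro!: sum.cong)
qed

lemma sum_upto_support:
  fixes f :: "nat \<Rightarrow> 'a :: comm_monoid_add"
  assumes "\<And>j. B \<le> j \<Longrightarrow> f j = 0" "B \<le> B'"
  shows "sum f {..<B'} = sum f {..<B}"
  by (rule sum.mono_neutral_right) (use assms in \<open>auto simp: not_less\<close>)

text \<open>
  The value does not depend on the bound. For the defect this rests on the fact that a node is
  greater than its parent: a node outside the support has no children in the support.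
\<close>

lemma gauge_upto_support:
  assumes y: "\<And>j. B \<le> j \<Longrightarrow> y j = 0" and "B \<le> B'"
  shows "gauge_upto T B' x\<^sub>0 x\<^sub>1 y = gauge_upto T B x\<^sub>0 x\<^sub>1 y"
proof -
  have inflow: "inflow B' y s = inflow B y s" for s
    unfolding inflow_def by (rule sum_upto_support) (use assms in auto)
  have "inflow B y s = 0" if "B \<le> s" for s
    unfolding inflow_def
  proof (rule sum.neutral, rule ballI)
    fix t assume "t \<in> {..<B}"
    then show "(if t \<noteq> 0 \<and> parent t = s then y t else 0) = 0"
      using parent_less[of t] that by auto
  qed
  then have "defect T B' y = defect T B y"
    unfolding defect_def inflow by (intro sum_upto_support) (use assms in auto)
  moreover have "(\<Sum>j<B'. \<bar>y j\<bar>) = (\<Sum>j<B. \<bar>y j\<bar>)" "(\<Sum>j<B'. y j) = (\<Sum>j<B. y j)"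
    by (rule sum_upto_support; use assms in simp)+
  ultimately show ?thesis
    by (simp add: gauge_upto_def)
qed

lemma tail_beyond_degree: "Poly_Mapping.degree v \<le> j \<Longrightarrow> tail v j = 0"
  by (simp add: tail_def beyond_degree_lookup_zero)

lemma tree_norm_upto:
  assumes "\<And>j. B \<le> j \<Longrightarrow> tail v j = 0"
  shows "tree_norm T v = gauge_upto T B (Poly_Mapping.lookup v 0) (Poly_Mapping.lookup v 1) (tail v)"
  unfolding tree_norm_def
  using gauge_upto_support[of B "tail v" "max B (Poly_Mapping.degree v)"]
    gauge_upto_support[of "Poly_Mapping.degree v" "tail v" "max B (Poly_Mapping.degree v)"]
    assms tail_beyond_degree by simp

lemma gauge_upto_le_iff:
  "gauge_upto T B x\<^sub>0 x\<^sub>1 y \<le> r \<longleftrightarrow> \<bar>x\<^sub>0\<bar> \<le> r \<and> \<bar>x\<^sub>1\<bar> \<le> r \<and> (\<Sum>j<B. \<bar>y j\<bar>) \<le> r \<and>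
     \<bar>x\<^sub>0 + x\<^sub>1 + (\<Sum>j<B. y j)\<bar> \<le> r \<and> \<bar>x\<^sub>0 - x\<^sub>1\<bar> / 2 + defect T B y \<le> r"
  by (auto simp: gauge_upto_def)

lemma le_gauge_upto:
  "\<bar>x\<^sub>0\<bar> \<le> gauge_upto T B x\<^sub>0 x\<^sub>1 y" "\<bar>x\<^sub>1\<bar> \<le> gauge_upto T B x\<^sub>0 x\<^sub>1 y"
  "(\<Sum>j<B. \<bar>y j\<bar>) \<le> gauge_upto T B x\<^sub>0 x\<^sub>1 y"
  "\<bar>x\<^sub>0 + x\<^sub>1 + (\<Sum>j<B. y j)\<bar> \<le> gauge_upto T B x\<^sub>0 x\<^sub>1 y"
  "\<bar>x\<^sub>0 - x\<^sub>1\<bar> / 2 + defect T B y \<le> gauge_upto T B x\<^sub>0 x\<^sub>1 y"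
  using gauge_upto_le_iff[of T B x\<^sub>0 x\<^sub>1 y "gauge_upto T B x\<^sub>0 x\<^sub>1 y"] by simp_all

lemma gauge_upto_add:
  "gauge_upto T B (x\<^sub>0 + z\<^sub>0) (x\<^sub>1 + z\<^sub>1) (\<lambda>j. y j + w j) \<le>
     gauge_upto T B x\<^sub>0 x\<^sub>1 y + gauge_upto T B z\<^sub>0 z\<^sub>1 w"
proof -
  let ?g = "gauge_upto T B x\<^sub>0 x\<^sub>1 y" and ?h = "gauge_upto T B z\<^sub>0 z\<^sub>1 w"
  note g = le_gauge_upto[where T = T and B = B and x\<^sub>0 = x\<^sub>0 and x\<^sub>1 = x\<^sub>1 and y = y]
  note h = le_gauge_upto[where T = T and B = B and x\<^sub>0 = z\<^sub>0 and x\<^sub>1 = z\<^sub>1 and y = w]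
  have "(\<Sum>j<B. \<bar>y j + w j\<bar>) \<le> (\<Sum>j<B. \<bar>y j\<bar> + \<bar>w j\<bar>)"
    by (intro sum_mono) simp
  then have "(\<Sum>j<B. \<bar>y j + w j\<bar>) \<le> ?g + ?h"
    using g(3) h(3) by (simp add: sum.distrib)
  moreover have "\<bar>x\<^sub>0 + z\<^sub>0 + (x\<^sub>1 + z\<^sub>1) + (\<Sum>j<B. y j + w j)\<bar> \<le> ?g + ?h"
    using g(4) h(4) by (simp add: sum.distrib abs_le_iff)
  moreover have "\<bar>(x\<^sub>0 + z\<^sub>0) - (x\<^sub>1 + z\<^sub>1)\<bar> / 2 + defect T B (\<lambda>j. y j + w j) \<le> ?g + ?h"
  proof -
    have combine: "a / 2 + f \<le> g + h"
      if "a \<le> b + c" "b / 2 + d \<le> g" "c / 2 + e \<le> h" "f \<le> d + e" for a b c d e f g h :: rat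
      using that by linarith
    have "(x\<^sub>0 + z\<^sub>0) - (x\<^sub>1 + z\<^sub>1) = (x\<^sub>0 - x\<^sub>1) + (z\<^sub>0 - z\<^sub>1)"
      by simp
    then have "\<bar>(x\<^sub>0 + z\<^sub>0) - (x\<^sub>1 + z\<^sub>1)\<bar> \<le> \<bar>x\<^sub>0 - x\<^sub>1\<bar> + \<bar>z\<^sub>0 - z\<^sub>1\<bar>"
      by (simp only: abs_triangle_ineq)
    then show ?thesis
      using g(5) h(5) defect_add by (rule combine)
  qed
  moreover have "\<bar>x\<^sub>0 + z\<^sub>0\<bar> \<le> ?g + ?h" "\<bar>x\<^sub>1 + z\<^sub>1\<bar> \<le> ?g + ?h"
    using g(1,2) h(1,2) by linarith+
  ultimately show ?thesis
    by (simp add: gauge_upto_le_iff)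
qed

lemma gauge_upto_scale:
  "gauge_upto T B (q * x\<^sub>0) (q * x\<^sub>1) (\<lambda>j. q * y j) = \<bar>q\<bar> * gauge_upto T B x\<^sub>0 x\<^sub>1 y"
proof -
  have "\<bar>q * x\<^sub>0 + q * x\<^sub>1 + (\<Sum>j<B. q * y j)\<bar> = \<bar>q\<bar> * \<bar>x\<^sub>0 + x\<^sub>1 + (\<Sum>j<B. y j)\<bar>"
    by (simp only: sum_distrib_left[symmetric] distrib_left[symmetric] abs_mult)
  moreover have "(\<Sum>j<B. \<bar>q * y j\<bar>) = \<bar>q\<bar> * (\<Sum>j<B. \<bar>y j\<bar>)"
    by (simp only: sum_distrib_left[symmetric] abs_mult)
  moreover have "\<bar>q * x\<^sub>0 - q * x\<^sub>1\<bar> / 2 + defect T B (\<lambda>j. q * y j) = \<bar>q\<bar> * (\<bar>x\<^sub>0 - x\<^sub>1\<bar> / 2 + defect T B y)"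
    by (simp only: right_diff_distrib[symmetric] abs_mult defect_scale distrib_left times_divide_eq_right)
  moreover have "max (\<bar>q\<bar> * a) (\<bar>q\<bar> * b) = \<bar>q\<bar> * max a b" for a b
    by (simp add: max_mult_distrib_left)
  ultimately show ?thesis
    by (simp only: gauge_upto_def abs_mult[of q])
qed

lemma rat_norm_tree_norm: "rat_norm (tree_norm T)"
  unfolding rat_norm_def
proof (intro conjI allI)
  have ge: "\<bar>Poly_Mapping.lookup v 0\<bar> \<le> tree_norm T v" "\<bar>Poly_Mapping.lookup v 1\<bar> \<le> tree_norm T v"
    "(\<Sum>j<Poly_Mapping.degree v. \<bar>tail v j\<bar>) \<le> tree_norm T v" for v
    unfolding tree_norm_def by (rule le_gauge_upto)+
  show nonneg: "0 \<le> tree_norm T v" for v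
    using ge(1)[of v] by linarith
  show "tree_norm T v = 0 \<longleftrightarrow> v = 0" for v
  proof
    assume 0: "tree_norm T v = 0"
    have "tail v j = 0" for j
    proof (cases "j < Poly_Mapping.degree v")
      case True
      have "(\<Sum>j<Poly_Mapping.degree v. \<bar>tail v j\<bar>) = 0"
        using ge(3)[of v] 0 by (intro antisym sum_nonneg) auto
      with True show ?thesis
        by (simp add: sum_nonneg_eq_0_iff)
    qed (simp add: tail_beyond_degree)
    then have "Poly_Mapping.lookup v (Suc (Suc j)) = 0" for j
      by (simp add: tail_def)
    moreover have "Poly_Mapping.lookup v 0 = 0" "Poly_Mapping.lookup v (Suc 0) = 0"
      using ge(1,2)[of v] 0 by simp_all
    ultimately have "Poly_Mapping.lookup v i = 0" for i
      by (metis not0_implies_Suc)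
    then show "v = 0"
      by (intro poly_mapping_eqI) simp
  next
    assume "v = 0"
    then show "tree_norm T v = 0"
      by (simp add: tree_norm_def gauge_upto_def defect_def)
  qed
  show "tree_norm T (scale q v) = \<bar>q\<bar> * tree_norm T v" for q v
  proof -
    have "tail (scale q v) = (\<lambda>j. q * tail v j)"
      by (simp add: tail_def fun_eq_iff)
    moreover from this have "tree_norm T (scale q v) = gauge_upto T (Poly_Mapping.degree v)
        (Poly_Mapping.lookup (scale q v) 0) (Poly_Mapping.lookup (scale q v) 1) (tail (scale q v))"
      by (intro tree_norm_upto) (simp add: tail_beyond_degree)
    ultimately show ?thesis
      by (simp add: gauge_upto_scale tree_norm_def)
  qed
  show "tree_norm T (v + w) \<le> tree_norm T v + tree_norm T w" for v w
  proof -
    let ?B = "max (Poly_Mapping.degree v) (Poly_Mapping.degree w)"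
    have tail: "tail (v + w) = (\<lambda>j. tail v j + tail w j)"
      by (simp add: tail_def fun_eq_iff lookup_add)
    have "tree_norm T u = gauge_upto T ?B (Poly_Mapping.lookup u 0) (Poly_Mapping.lookup u 1) (tail u)"
      if "u \<in> {v, w, v + w}" for u
      using that by (intro tree_norm_upto) (auto simp: tail tail_beyond_degree)
    then show ?thesis
      by (simp add: tail lookup_add gauge_upto_add)
  qed
qed

section \<open>From a common point of the balls to a branch\<close>

text \<open>
  Closure under parents brings the root into \<open>P\<close>; from there on children in \<open>P\<close> are chosen. The
  resulting branch need not pass through \<open>t\<close>.
\<close>

lemma branch_if_pruned:
  assumes "P t" and up: "\<And>t. P t \<Longrightarrow> t \<noteq> 0 \<Longrightarrow> P (parent t)" and down: "\<And>s. P s \<Longrightarrow> \<exists>i. P (child i s)"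
  shows "\<exists>\<beta>. \<forall>m. P (branch \<beta> m)"
proof -
  have "P 0"
    using \<open>P t\<close>
  proof (induction t rule: less_induct)
    case (less t)
    show ?case
    proof (cases "t = 0")
      case False
      then show ?thesis
        using less.IH[OF parent_less up] less.prems by simp
    qed (use less.prems in simp)
  qed
  obtain next_label where nl: "\<And>s. P s \<Longrightarrow> P (child (next_label s) s)"
    using down by metis
  define node where "node m = ((\<lambda>s. child (next_label s) s) ^^ m) 0" for m
  have node: "P (node m)" for m
    by (induction m) (simp_all add: node_def \<open>P 0\<close> nl)
  have "branch (\<lambda>m. next_label (node m)) m = node m" for m
    by (induction m) (simp_all add: node_def)
  with node have "\<forall>m. P (branch (\<lambda>m. next_label (node m)) m)"
    by simp
  then show ?thesis
    by blast
qed

text \<open>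
  If a Cauchy sequence in \<open>\<ell>\<^sup>1\<close> has a positive sum over \<open>A\<close> in the limit, then some single entry
  with index in \<open>A\<close> stays away from \<open>0\<close>. One late member \<open>y K\<close> of the sequence has a finite
  support, and outside this support all later members have small mass. So the sum over \<open>A\<close> is
  essentially a sum of boundedly many terms, and one of them is large; that it stays large
  follows from a second application of the Cauchy condition.
\<close>

lemma positive_limit_of_partial_sums:
  fixes y :: "nat \<Rightarrow> nat \<Rightarrow> rat"
  assumes supp: "\<And>k j. B k \<le> j \<Longrightarrow> y k j = 0"
    and cauchy: "\<And>\<epsilon>. 0 < \<epsilon> \<Longrightarrow> \<exists>K. \<forall>k\<ge>K. \<forall>l\<ge>K. \<forall>D. (\<Sum>j<D. \<bar>y k j - y l j\<bar>) \<le> \<epsilon>"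
    and "0 < \<delta>"
    and ev: "\<forall>\<^sub>F k in sequentially. \<delta> \<le> (\<Sum>j<B k. if A j then y k j else 0)"
  shows "\<exists>j. A j \<and> (\<exists>\<delta>>0. \<forall>\<^sub>F k in sequentially. \<delta> \<le> y k j)"
proof -
  obtain K where K: "\<And>k l D. K \<le> k \<Longrightarrow> K \<le> l \<Longrightarrow> (\<Sum>j<D. \<bar>y k j - y l j\<bar>) \<le> \<delta> / 2"
    using cauchy[of "\<delta> / 2"] \<open>0 < \<delta>\<close> by auto
  define N where "N = B K"
  \<comment> \<open>outside the support of \<open>y K\<close> there is at most the mass \<open>\<delta> / 2\<close>\<close>
  have head: "\<delta> / 2 \<le> (\<Sum>j<N. if A j then y k j else 0)"
    if "K \<le> k" and k: "\<delta> \<le> (\<Sum>j<B k. if A j then y k j else 0)" for k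
  proof -
    define D where "D = max N (B k)"
    have "(\<Sum>j<B k. if A j then y k j else 0) = (\<Sum>j<D. if A j then y k j else 0)"
      by (rule sum_upto_support[symmetric]) (auto simp: supp D_def)
    also have "\<dots> \<le> (\<Sum>j<D. (if j < N then if A j then y k j else 0 else 0) + \<bar>y k j - y K j\<bar>)"
      by (intro sum_mono) (auto simp: supp N_def abs_if)
    also have "\<dots> = (\<Sum>j<N. if A j then y k j else 0) + (\<Sum>j<D. \<bar>y k j - y K j\<bar>)"
    proof -
      have "(\<Sum>j<D. if j < N then if A j then y k j else 0 else 0) =
          (\<Sum>j<N. if j < N then if A j then y k j else 0 else 0)"
        by (rule sum_upto_support) (auto simp: D_def)
      then show ?thesis
        by (simp add: sum.distrib)
    qed
    finally show ?thesis
      using k K[OF \<open>K \<le> k\<close> order_refl, of D] by linarith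
  qed
  obtain K' where K': "\<And>k. K' \<le> k \<Longrightarrow> \<delta> \<le> (\<Sum>j<B k. if A j then y k j else 0)"
    using ev by (auto simp: eventually_sequentially)
  have "0 < N"
    using head[of "max K K'"] K'[of "max K K'"] \<open>0 < \<delta>\<close> by (intro gr0I) auto
  \<comment> \<open>some of the \<open>N\<close> entries is at least \<open>\<delta> / (2 * N) = 2 * \<eta>\<close> and changes by at most \<open>\<eta>\<close> later\<close>
  define \<eta> where "\<eta> = \<delta> / (4 * of_nat N)"
  have "0 < \<eta>"
    using \<open>0 < \<delta>\<close> \<open>0 < N\<close> by (simp add: \<eta>_def)
  then obtain K2 where K2: "\<And>k l D. K2 \<le> k \<Longrightarrow> K2 \<le> l \<Longrightarrow> (\<Sum>j<D. \<bar>y k j - y l j\<bar>) \<le> \<eta>"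
    using cauchy by blast
  define k0 where "k0 = max K2 (max K K')"
  have kk: "K \<le> k0" "K' \<le> k0"
    by (simp_all add: k0_def)
  have "\<exists>j<N. A j \<and> 2 * \<eta> \<le> y k0 j"
  proof (rule ccontr)
    assume "\<not> ?thesis"
    then have "(\<Sum>j<N. if A j then y k0 j else 0) < (\<Sum>j<N. 2 * \<eta>)"
      using \<open>0 < N\<close> \<open>0 < \<eta>\<close> by (intro sum_strict_mono) (auto simp: not_le)
    also have "\<dots> = \<delta> / 2"
      using \<open>0 < N\<close> by (simp add: \<eta>_def)
    finally show False
      using head[OF _ K', of k0] kk by simp
  qed
  then obtain j where j: "A j" "2 * \<eta> \<le> y k0 j"
    by blast
  have "\<eta> \<le> y k j" if "k0 \<le> k" for k
  proof -
    have "\<bar>y k j - y k0 j\<bar> \<le> (\<Sum>i<Suc j. \<bar>y k i - y k0 i\<bar>)"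
      by (rule member_le_sum) auto
    also have "\<dots> \<le> \<eta>"
      using that by (intro K2) (auto simp: k0_def)
    finally show ?thesis
      using j(2) by linarith
  qed
  then have "\<forall>\<^sub>F k in sequentially. \<eta> \<le> y k j"
    by (auto simp: eventually_sequentially)
  with j(1) \<open>0 < \<eta>\<close> show ?thesis
    by blast
qed

text \<open>
  The combinatorial content of the direction from points to branches, free of completions: \<open>y k\<close>
  is a flow of total mass \<open>1\<close> on \<open>T\<close> up to an error that tends to \<open>0\<close>. The nodes whose mass
  stays bounded away from \<open>0\<close> lie in \<open>T\<close>, and there is one because the total mass does not
  vanish. They are closed under parents because half of the mass of the parent is the inflow of
  its children, which is at least the mass of any single child up to negligible negative
  entries, and each of them has a child of the same kind because its inflow does not vanish.
\<close>

lemma branch_of_approximate_flow: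
  fixes y :: "nat \<Rightarrow> nat \<Rightarrow> rat"
  assumes supp: "\<And>k j. B k \<le> j \<Longrightarrow> y k j = 0"
    and cauchy: "\<And>\<epsilon>. 0 < \<epsilon> \<Longrightarrow> \<exists>K. \<forall>k\<ge>K. \<forall>l\<ge>K. \<forall>D. (\<Sum>j<D. \<bar>y k j - y l j\<bar>) \<le> \<epsilon>"
    and ev: "\<And>\<epsilon>. 0 < \<epsilon> \<Longrightarrow> \<forall>\<^sub>F k in sequentially. (\<Sum>j<B k. \<bar>y k j\<bar>) \<le> 1 + \<epsilon> \<and>
        1 - \<epsilon> \<le> (\<Sum>j<B k. y k j) \<and> defect T (B k) (y k) \<le> \<epsilon>"
  shows "\<exists>\<beta>. \<forall>m. T (branch \<beta> m)"
proof -
  define Pos where "Pos j \<longleftrightarrow> (\<exists>\<delta>>0. \<forall>\<^sub>F k in sequentially. \<delta> \<le> y k j)" for j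
  note Pos_of_sum = positive_limit_of_partial_sums[OF supp cauchy, folded Pos_def]
  have terms: "\<bar>y k s / 2 - inflow (B k) (y k) s\<bar> + (if T s then 0 else \<bar>y k s\<bar>) \<le> defect T (B k) (y k)"
    if "s < B k" for k s
    unfolding defect_def using that
    by (intro member_le_sum[where f = "\<lambda>s. \<bar>y k s / 2 - inflow (B k) (y k) s\<bar> + (if T s then 0 else \<bar>y k s\<bar>)"]) auto
  have balance: "\<bar>y k s / 2 - inflow (B k) (y k) s\<bar> \<le> defect T (B k) (y k)" if "s < B k" for k s
    by (rule order_trans[OF _ terms[OF that]]) simp
  have off_tree: "\<bar>y k s\<bar> \<le> defect T (B k) (y k)" if "s < B k" "\<not> T s" for k s
    by (rule order_trans[OF _ terms[OF that(1)]]) (simp add: that(2))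
  have in_supp: "j < B k" if "y k j \<noteq> 0" for j k
    using supp[of k j] that by (meson not_le)
  have T: "T s" if "Pos s" for s
  proof (rule ccontr)
    assume "\<not> T s"
    obtain \<delta> where \<delta>: "0 < \<delta>" "\<forall>\<^sub>F k in sequentially. \<delta> \<le> y k s"
      using \<open>Pos s\<close> unfolding Pos_def by blast
    have small: "0 < \<delta> / 2"
      using \<delta>(1) by simp
    have "\<forall>\<^sub>F k in sequentially. False"
      using \<delta>(2) ev[OF small]
    proof eventually_elim
      case (elim k)
      then have "\<bar>y k s\<bar> \<le> \<delta> / 2"
        using off_tree[OF in_supp \<open>\<not> T s\<close>, of k] \<open>0 < \<delta>\<close> by auto
      then show False
        using elim(1) \<open>0 < \<delta>\<close> by simp
    qed
    then show False
      by simp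
  qed
  have down: "\<exists>i. Pos (child i s)" if "Pos s" for s
  proof -
    obtain \<delta> where \<delta>: "0 < \<delta>" "\<forall>\<^sub>F k in sequentially. \<delta> \<le> y k s"
      using \<open>Pos s\<close> unfolding Pos_def by blast
    have small: "0 < \<delta> / 4"
      using \<delta>(1) by simp
    have "\<forall>\<^sub>F k in sequentially. \<delta> / 4 \<le> inflow (B k) (y k) s"
      using \<delta>(2) ev[OF small]
    proof eventually_elim
      case (elim k)
      then have "\<bar>y k s / 2 - inflow (B k) (y k) s\<bar> \<le> \<delta> / 4"
        using balance[OF in_supp, of k s] \<open>0 < \<delta>\<close> by auto
      then show ?case
        using elim(1) by linarith
    qed
    then obtain t where "t \<noteq> 0" "parent t = s" "Pos t"
      using Pos_of_sum[where \<delta> = "\<delta> / 4" and A = "\<lambda>t. t \<noteq> 0 \<and> parent t = s"] \<delta>(1) by (auto simp: inflow_def)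
    then show ?thesis
      by (metis child_label_parent)
  qed
  have up: "Pos (parent t)" if "Pos t" "t \<noteq> 0" for t
  proof -
    let ?s = "parent t"
    obtain \<delta> where \<delta>: "0 < \<delta>" "\<forall>\<^sub>F k in sequentially. \<delta> \<le> y k t"
      using \<open>Pos t\<close> unfolding Pos_def by blast
    have small: "0 < \<delta> / 4"
      using \<delta>(1) by simp
    have "\<forall>\<^sub>F k in sequentially. \<delta> / 2 \<le> y k ?s"
      using \<delta>(2) ev[OF small]
    proof eventually_elim
      case (elim k)
      have t: "t < B k" "?s < B k"
        using in_supp[of k t] elim(1) \<open>0 < \<delta>\<close> parent_less[OF \<open>t \<noteq> 0\<close>] by force+
      \<comment> \<open>\<open>(\<bar>y k j\<bar> - y k j) / 2\<close> is the negative part of an entry, and these parts have a sum of at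
         most \<open>\<delta> / 4\<close>\<close>
      have combine: "3 * \<delta> / 4 \<le> f"
        if "a \<le> f + (m - s) / 2" "\<delta> \<le> a" "m \<le> 1 + \<delta> / 4" "1 - \<delta> / 4 \<le> s" for a f m s :: rat
        using that by (simp add: field_simps)
      have "y k t \<le> (\<Sum>j<B k. if j = t then y k t else 0)"
        using t by simp
      also have "\<dots> \<le> (\<Sum>j<B k. (if j \<noteq> 0 \<and> parent j = ?s then y k j else 0) + (\<bar>y k j\<bar> - y k j) / 2)"
        using \<open>t \<noteq> 0\<close> by (intro sum_mono) (auto simp: field_simps abs_if)
      also have "\<dots> = inflow (B k) (y k) ?s + ((\<Sum>j<B k. \<bar>y k j\<bar>) - (\<Sum>j<B k. y k j)) / 2"
        by (simp add: inflow_def sum.distrib sum_divide_distrib[symmetric] sum_subtractf)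
      finally have "3 * \<delta> / 4 \<le> inflow (B k) (y k) ?s"
        using elim(1) conjunct1[OF elim(2)] conjunct1[OF conjunct2[OF elim(2)]] by (rule combine)
      moreover have "\<bar>y k ?s / 2 - inflow (B k) (y k) ?s\<bar> \<le> \<delta> / 4"
        using balance[OF t(2)] elim(2) by (meson order_trans)
      ultimately show ?case
        using \<open>0 < \<delta>\<close> by linarith
    qed
    then show ?thesis
      unfolding Pos_def using \<delta>(1) half_gt_zero by blast
  qed
  have "\<forall>\<^sub>F k in sequentially. 1 / 2 \<le> (\<Sum>j<B k. y k j)"
    using ev[of "1 / 2"] by (simp add: eventually_mono)
  then obtain t where "Pos t"
    using Pos_of_sum[where \<delta> = "1 / 2" and A = "\<lambda>_. True"] by auto
  then have "\<exists>\<beta>. \<forall>m. Pos (branch \<beta> m)"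
    using branch_if_pruned up down by blast
  then show ?thesis
    using T by blast
qed

text \<open>
  The tails of the members of a Cauchy sequence that represents \<open>x\<close> form an approximate flow:
  from some index on the members have distance at most \<open>1 + \<eta>\<close> from the centres, and then their
  first two coordinates differ from \<open>1\<close> by at most \<open>\<eta>\<close>.
\<close>

lemma branch_of_ball_intersection:
  assumes x: "x \<in> completion_cball (tree_norm T) (prepend2 2 0 0) 1"
    "x \<in> completion_cball (tree_norm T) (prepend2 0 2 0) 1"
    "x \<in> completion_cball (tree_norm T) (prepend2 2 2 0) 1"
  shows "\<exists>\<beta>. \<forall>m. T (branch \<beta> m)"
proof -
  let ?d = "norm_dist (tree_norm T)"
  interpret Metric_space UNIV ?d
    by (rule Metric_space_norm_dist[OF rat_norm_tree_norm])
  have X: "x \<in> completion_space ?d"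
    using x by (simp add: in_completion_cball rat_norm_tree_norm)
  then obtain \<sigma> where \<sigma>: "\<sigma> \<in> x"
    using completion_nonempty[OF Metric_space_axioms] by blast
  have near: "\<forall>\<^sub>F k in sequentially. tree_norm T (v - \<sigma> k) \<le> 1 + \<epsilon>"
    if v: "x \<in> completion_cball (tree_norm T) v 1" and "0 < \<epsilon>" for v \<epsilon>
  proof -
    have "(\<lambda>k. ?d v (\<sigma> k)) \<longlonglongrightarrow> completion_dist ?d (completion_embed ?d v) x"
      using completion_dist_tendsto[OF Metric_space_axioms completion_embed_in[OF Metric_space_axioms] X
          const_in_completion_embed[OF Metric_space_axioms] \<sigma>] .
    moreover have "completion_dist ?d (completion_embed ?d v) x < real_of_rat (1 + \<epsilon>)"
      using v \<open>0 < \<epsilon>\<close> zero_less_of_rat_iff[where 'a = real, of \<epsilon>]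
      by (simp add: in_completion_cball rat_norm_tree_norm of_rat_add del: zero_less_of_rat_iff)
    ultimately have "\<forall>\<^sub>F k in sequentially. ?d v (\<sigma> k) < real_of_rat (1 + \<epsilon>)"
      by (rule order_tendstoD(2))
    then show ?thesis
      by eventually_elim (simp add: norm_dist_def of_rat_less)
  qed
  define y where "y k = tail (\<sigma> k)" for k
  define B where "B k = Poly_Mapping.degree (\<sigma> k)" for k
  have supp: "y k j = 0" if "B k \<le> j" for k j
    using that by (simp add: y_def B_def tail_beyond_degree)
  show ?thesis
  proof (rule branch_of_approximate_flow[OF supp])
    fix \<epsilon> :: rat assume "0 < \<epsilon>"
    have "MCauchy \<sigma>"
      using completion_memD(1)[OF Metric_space_axioms X \<sigma>] .
    then obtain K where K: "\<And>k l. K \<le> k \<Longrightarrow> K \<le> l \<Longrightarrow> ?d (\<sigma> k) (\<sigma> l) < real_of_rat \<epsilon>"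
      unfolding MCauchy_def using \<open>0 < \<epsilon>\<close> by (meson zero_less_of_rat_iff)
    have "(\<Sum>j<D. \<bar>y k j - y l j\<bar>) \<le> \<epsilon>" if "K \<le> k" "K \<le> l" for k l D
    proof -
      let ?D = "max D (max (B k) (B l))"
      have tail: "tail (\<sigma> k - \<sigma> l) = (\<lambda>j. y k j - y l j)"
        by (simp add: y_def tail_def lookup_minus fun_eq_iff)
      have "(\<Sum>j<D. \<bar>y k j - y l j\<bar>) \<le> (\<Sum>j<?D. \<bar>y k j - y l j\<bar>)"
        by (rule sum_mono2) auto
      also have "\<dots> \<le> tree_norm T (\<sigma> k - \<sigma> l)"
        by (subst tree_norm_upto[where B = ?D]) (simp_all add: tail supp le_gauge_upto(3))
      also have "\<dots> \<le> \<epsilon>"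
        using K[OF that] by (simp add: norm_dist_def of_rat_less)
      finally show ?thesis .
    qed
    then show "\<exists>K. \<forall>k\<ge>K. \<forall>l\<ge>K. \<forall>D. (\<Sum>j<D. \<bar>y k j - y l j\<bar>) \<le> \<epsilon>"
      by blast
  next
    fix \<epsilon> :: rat assume "0 < \<epsilon>"
    \<comment> \<open>the lower bound for the total mass adds up the error \<open>\<eta>\<close> of the third distance and those of
       two coordinates\<close>
    define \<eta> where "\<eta> = \<epsilon> / 3"
    have "0 < \<eta>"
      using \<open>0 < \<epsilon>\<close> by (simp add: \<eta>_def)
    show "\<forall>\<^sub>F k in sequentially. (\<Sum>j<B k. \<bar>y k j\<bar>) \<le> 1 + \<epsilon> \<and>
        1 - \<epsilon> \<le> (\<Sum>j<B k. y k j) \<and> defect T (B k) (y k) \<le> \<epsilon>"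
      using near[OF x(1) \<open>0 < \<eta>\<close>] near[OF x(2) \<open>0 < \<eta>\<close>] near[OF x(3) \<open>0 < \<eta>\<close>]
    proof eventually_elim
      case (elim k)
      let ?x0 = "Poly_Mapping.lookup (\<sigma> k) 0" and ?x1 = "Poly_Mapping.lookup (\<sigma> k) (Suc 0)"
      have tail: "tail (prepend2 a b 0 - \<sigma> k) = (\<lambda>j. - 1 * y k j)" for a b
        by (simp add: y_def tail_def lookup_minus lookup_prepend2 fun_eq_iff)
      have norm: "tree_norm T (prepend2 a b 0 - \<sigma> k) =
          gauge_upto T (B k) (a - ?x0) (b - ?x1) (\<lambda>j. - 1 * y k j)" for a b
        unfolding tail[symmetric, of a b]
        by (subst tree_norm_upto[where B = "B k"])
          (simp_all add: tail supp lookup_minus lookup_prepend2)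
      note le = elim[unfolded norm gauge_upto_le_iff defect_scale]
      have squeeze: "\<bar>a - 1\<bar> \<le> \<eta>" if "\<bar>2 - a\<bar> \<le> 1 + \<eta>" "\<bar>a\<bar> \<le> 1 + \<eta>" for a
        using that by linarith
      have x0: "\<bar>?x0 - 1\<bar> \<le> \<eta>" and x1: "\<bar>?x1 - 1\<bar> \<le> \<eta>"
        by (rule squeeze; use le(1,2) in simp)+
      have "(\<Sum>j<B k. \<bar>y k j\<bar>) \<le> 1 + \<eta>"
        using le(1) by simp
      moreover have "1 - \<epsilon> \<le> (\<Sum>j<B k. y k j)"
      proof -
        have "4 - ?x0 - ?x1 - (\<Sum>j<B k. y k j) \<le> 1 + \<eta>"
          using le(3) by (simp add: sum_negf abs_le_iff)
        then show ?thesis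
          using x0 x1 unfolding \<eta>_def by linarith
      qed
      moreover have "defect T (B k) (y k) \<le> \<epsilon>"
      proof -
        have "(2 - ?x0 + ?x1) / 2 + defect T (B k) (y k) \<le> \<bar>2 - ?x0 + ?x1\<bar> / 2 + defect T (B k) (y k)"
          by (intro add_right_mono divide_right_mono) simp_all
        also have "\<dots> \<le> 1 + \<eta>"
          using le(1) by simp
        finally have "2 - ?x0 + ?x1 + 2 * defect T (B k) (y k) \<le> 2 + 2 * \<eta>"
          by (simp add: field_simps)
        then show ?thesis
          using x0 x1 unfolding \<eta>_def by linarith
      qed
      ultimately show ?case
        using \<open>0 < \<epsilon>\<close> by (simp add: \<eta>_def)
    qed
  qed
qed

section \<open>From a branch to a common point of the balls\<close>

definition branch_flow :: "(nat \<Rightarrow> nat) \<Rightarrow> nat \<Rightarrow> nat \<Rightarrow> rat" where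
  "branch_flow \<beta> k j = (\<Sum>m<k. if branch \<beta> m = j then (1/2) ^ Suc m else 0)"

lemma branch_flow_Suc:
  "branch_flow \<beta> (Suc k) j = branch_flow \<beta> k j + (if branch \<beta> k = j then (1/2) ^ Suc k else 0)"
  by (simp add: branch_flow_def)

lemma branch_flow_support: "(\<And>m. m < k \<Longrightarrow> branch \<beta> m < D) \<Longrightarrow> D \<le> j \<Longrightarrow> branch_flow \<beta> k j = 0"
  unfolding branch_flow_def by (intro sum.neutral) force

lemma branch_flow_nonneg: "0 \<le> branch_flow \<beta> k j"
  unfolding branch_flow_def by (intro sum_nonneg) simp

lemma branch_flow_mono: "k \<le> l \<Longrightarrow> branch_flow \<beta> k j \<le> branch_flow \<beta> l j"
  unfolding branch_flow_def by (intro sum_mono2) auto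

lemma sum_branch_flow:
  assumes "\<And>m. m < k \<Longrightarrow> branch \<beta> m < D"
  shows "(\<Sum>j<D. branch_flow \<beta> k j) = 1 - (1/2) ^ k"
  using assms
proof (induction k)
  case (Suc k)
  then have "(\<Sum>j<D. if branch \<beta> k = j then (1/2) ^ Suc k else 0) = ((1/2) ^ Suc k :: rat)"
    by (subst sum.delta') auto
  with Suc show ?case
    by (simp add: branch_flow_Suc sum.distrib)
qed (simp add: branch_flow_def)

text \<open>
  Every node of the truncated branch except the last one hands half of its mass to the next one.
\<close>

lemma imbalance_branch_flow:
  assumes "\<And>m. m < k \<Longrightarrow> branch \<beta> m < D"
  shows "branch_flow \<beta> k s / 2 - inflow D (branch_flow \<beta> k) s =
    (if 0 < k \<and> branch \<beta> (k - 1) = s then (1/2) ^ Suc k else 0)"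
  using assms
proof (induction k)
  case (Suc k)
  let ?c = "(1/2) ^ Suc k :: rat"
  let ?e = "\<lambda>j. if branch \<beta> k = j then ?c else 0"
  have "inflow D ?e s = (\<Sum>t<D. if branch \<beta> k = t then if 0 < k \<and> branch \<beta> (k - 1) = s then ?c else 0 else 0)"
    unfolding inflow_def by (intro sum.cong refl) (cases k; auto)
  also have "\<dots> = (if 0 < k \<and> branch \<beta> (k - 1) = s then ?c else 0)"
    using Suc.prems[of k] by (subst sum.delta') auto
  finally have inflow: "inflow D (branch_flow \<beta> (Suc k)) s =
      inflow D (branch_flow \<beta> k) s + (if 0 < k \<and> branch \<beta> (k - 1) = s then ?c else 0)"
    unfolding branch_flow_Suc by (subst inflow_add) simp
  have half: "branch_flow \<beta> (Suc k) s / 2 =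
      branch_flow \<beta> k s / 2 + (if branch \<beta> k = s then (1/2) ^ Suc (Suc k) else 0)"
    by (simp add: branch_flow_Suc add_divide_distrib)
  have cancel: "(a + d) - (i + c) = d" if "a - i = c" for a c d i :: rat
    using that by simp
  have "branch_flow \<beta> k s / 2 - inflow D (branch_flow \<beta> k) s =
      (if 0 < k \<and> branch \<beta> (k - 1) = s then ?c else 0)"
    using Suc by simp
  from cancel[OF this] show ?case
    unfolding inflow half by simp
qed (simp add: branch_flow_def inflow_def cong: if_cong)

lemma defect_branch_flow:
  assumes D: "\<And>m. m < k \<Longrightarrow> branch \<beta> m < D" and T: "\<And>m. T (branch \<beta> m)"
  shows "defect T D (branch_flow \<beta> k) \<le> (1/2) ^ Suc k"
proof -
  have off: "branch_flow \<beta> k s = 0" if "\<not> T s" for s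
    unfolding branch_flow_def using that T by (intro sum.neutral) auto
  have "defect T D (branch_flow \<beta> k) = (\<Sum>s<D. if branch \<beta> (k - 1) = s then if 0 < k then (1/2) ^ Suc k else 0 else 0)"
    unfolding defect_def by (intro sum.cong refl) (simp add: imbalance_branch_flow[OF D] off)
  also have "\<dots> \<le> (1/2) ^ Suc k"
    by (subst sum.delta') auto
  finally show ?thesis .
qed

definition branch_point :: "(nat \<Rightarrow> nat) \<Rightarrow> nat \<Rightarrow> N" where
  "branch_point \<beta> k = prepend2 1 1 (\<Sum>m<k. Poly_Mapping.single (branch \<beta> m) ((1/2) ^ Suc m))"

lemma branch_point_simps [simp]:
  "Poly_Mapping.lookup (branch_point \<beta> k) 0 = 1"
  "Poly_Mapping.lookup (branch_point \<beta> k) (Suc 0) = 1"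
  "tail (branch_point \<beta> k) = branch_flow \<beta> k"
  by (simp_all add: branch_point_def lookup_prepend2 tail_def fun_eq_iff lookup_sum lookup_single
      when_def branch_flow_def cong: if_cong)

lemma branch_bounded: "\<exists>D. \<forall>m<k. branch \<beta> m < D"
proof -
  have "finite (branch \<beta> ` {..<k})"
    by simp
  then show ?thesis
    by (auto simp: finite_nat_set_iff_bounded)
qed

lemma tree_norm_branch_point_diff:
  assumes T: "\<And>m. T (branch \<beta> m)" and "k \<le> l"
  shows "tree_norm T (branch_point \<beta> l - branch_point \<beta> k) \<le> 2 * (1/2) ^ k"
proof -
  obtain D where D: "\<And>m. m < l \<Longrightarrow> branch \<beta> m < D"
    using branch_bounded by blast
  then have Dk: "\<And>m. m < k \<Longrightarrow> branch \<beta> m < D"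
    using \<open>k \<le> l\<close> by simp
  let ?y = "\<lambda>j. branch_flow \<beta> l j + - 1 * branch_flow \<beta> k j"
  have tail: "tail (branch_point \<beta> l - branch_point \<beta> k) = ?y"
    by (simp add: fun_eq_iff tail_def lookup_minus flip: branch_point_simps(3))
  have sum: "(\<Sum>j<D. ?y j) = (1/2) ^ k - (1/2) ^ l"
    by (simp add: sum_subtractf sum_branch_flow[OF D] sum_branch_flow[OF Dk])
  have "(\<Sum>j<D. \<bar>?y j\<bar>) = (\<Sum>j<D. ?y j)"
    using branch_flow_mono[OF \<open>k \<le> l\<close>] by (intro sum.cong) auto
  moreover have le: "(1/2 :: rat) ^ l \<le> (1/2) ^ k"
    using \<open>k \<le> l\<close> by (intro power_decreasing) auto
  have pos: "0 < (1/2 :: rat) ^ l"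
    by simp
  have "defect T D ?y \<le> (1/2) ^ l / 2 + (1/2) ^ k / 2"
    using defect_add[of T D "branch_flow \<beta> l" "\<lambda>j. - 1 * branch_flow \<beta> k j"]
      defect_branch_flow[of l \<beta> D T, OF D T] defect_branch_flow[of k \<beta> D T, OF Dk T]
    unfolding defect_scale by simp
  then have "defect T D ?y \<le> 2 * (1/2) ^ k"
    using le pos by linarith
  moreover have "\<bar>(1/2 :: rat) ^ k - (1/2) ^ l\<bar> \<le> 2 * (1/2) ^ k"
    using le pos by (intro abs_leI) linarith+
  ultimately have "gauge_upto T D 0 0 ?y \<le> 2 * (1/2) ^ k"
    unfolding gauge_upto_le_iff sum by simp
  moreover have "tree_norm T (branch_point \<beta> l - branch_point \<beta> k) = gauge_upto T D 0 0 ?y"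
    unfolding tail[symmetric]
    by (subst tree_norm_upto[where B = D])
      (simp_all add: tail lookup_minus branch_flow_support[OF D] branch_flow_support[OF Dk])
  ultimately show ?thesis
    by simp
qed

text \<open>
  The excess over \<open>1\<close> comes from the truncation: the missing mass \<open>1 / 2\<^sup>k\<close> enters the fourth
  term of the norm, and the imbalance at the last node enters the fifth.
\<close>

lemma tree_norm_centre_diff:
  assumes T: "\<And>m. T (branch \<beta> m)" and v: "v \<in> {prepend2 2 0 0, prepend2 0 2 0, prepend2 2 2 0}"
  shows "tree_norm T (v - branch_point \<beta> k) \<le> 1 + (1/2) ^ k"
proof -
  obtain D where D: "\<And>m. m < k \<Longrightarrow> branch \<beta> m < D"
    using branch_bounded by blast
  let ?y = "\<lambda>j. - 1 * branch_flow \<beta> k j"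
  have tail: "tail (prepend2 a b 0 - branch_point \<beta> k) = ?y" for a b
    by (simp add: fun_eq_iff tail_def lookup_minus lookup_prepend2 flip: branch_point_simps(3))
  have norm: "tree_norm T (prepend2 a b 0 - branch_point \<beta> k) = gauge_upto T D (a - 1) (b - 1) ?y" for a b
    unfolding tail[symmetric, of a b]
    by (subst tree_norm_upto[where B = D])
      (simp_all add: tail lookup_minus lookup_prepend2 branch_flow_support[OF D])
  have abs: "(\<Sum>j<D. \<bar>?y j\<bar>) = 1 - (1/2) ^ k"
    by (simp add: sum_branch_flow[OF D] branch_flow_nonneg)
  have sum: "(\<Sum>j<D. ?y j) = (1/2) ^ k - 1"
    by (simp add: sum_negf sum_branch_flow[OF D])
  have "(1/2 :: rat) ^ k \<le> 1"
    by (simp add: power_le_one)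
  moreover have pos: "0 < (1/2 :: rat) ^ k"
    by simp
  moreover have "defect T D ?y \<le> (1/2) ^ k / 2"
    unfolding defect_scale using defect_branch_flow[of k \<beta> D T, OF D T] by simp
  then have "defect T D ?y \<le> (1/2) ^ k" "defect T D ?y \<le> 1 + (1/2) ^ k"
    using pos by linarith+
  ultimately have "gauge_upto T D a b ?y \<le> 1 + (1/2) ^ k" if "(a, b) \<in> {(1, -1), (-1, 1), (1, 1)}" for a b
    unfolding gauge_upto_le_iff abs sum using that by auto
  then show ?thesis
    using v by (auto simp: norm)
qed

lemma ball_intersection_of_branch:
  assumes T: "\<And>m. T (branch \<beta> m)"
  shows "\<exists>x. \<forall>v\<in>{prepend2 2 0 0, prepend2 0 2 0, prepend2 2 2 0}. x \<in> completion_cball (tree_norm T) v 1"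
proof -
  let ?d = "norm_dist (tree_norm T)"
  interpret Metric_space UNIV ?d
    by (rule Metric_space_norm_dist[OF rat_norm_tree_norm])
  have close: "?d (branch_point \<beta> l) (branch_point \<beta> k) \<le> 2 * (1/2) ^ k" if "k \<le> l" for k l
  proof -
    have "?d (branch_point \<beta> l) (branch_point \<beta> k) \<le> real_of_rat (2 * (1/2) ^ k)"
      unfolding norm_dist_def of_rat_less_eq using T that by (rule tree_norm_branch_point_diff)
    then show ?thesis
      by (simp add: of_rat_mult of_rat_power of_rat_divide)
  qed
  have null: "(\<lambda>k. (1/2 :: real) ^ k) \<longlonglongrightarrow> 0"
    by (rule LIMSEQ_power_zero) simp
  have C: "MCauchy (branch_point \<beta>)"
    unfolding MCauchy_def
  proof (intro conjI allI impI)
    fix \<epsilon> :: real assume "0 < \<epsilon>"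
    then have "\<forall>\<^sub>F k in sequentially. (1/2) ^ k < \<epsilon> / 4"
      by (intro order_tendstoD(2)[OF null]) simp
    then obtain K where K: "(1/2) ^ K < \<epsilon> / 4"
      by (auto simp: eventually_sequentially)
    have "?d (branch_point \<beta> k) (branch_point \<beta> l) < \<epsilon>" if "K \<le> k" "K \<le> l" for k l
    proof -
      have "?d (branch_point \<beta> k) (branch_point \<beta> l) \<le>
          ?d (branch_point \<beta> k) (branch_point \<beta> K) + ?d (branch_point \<beta> K) (branch_point \<beta> l)"
        by (rule triangle) simp_all
      then show ?thesis
        using close[OF that(1)] close[OF that(2)] K by (simp add: commute)
    qed
    then show "\<exists>N. \<forall>n n'. N \<le> n \<longrightarrow> N \<le> n' \<longrightarrow> ?d (branch_point \<beta> n) (branch_point \<beta> n') < \<epsilon>"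
      by blast
  qed simp
  define x where "x = cauchy_equiv ?d `` {branch_point \<beta>}"
  have x: "x \<in> completion_space ?d" "branch_point \<beta> \<in> x"
    using class_in_completion[OF Metric_space_axioms C] self_in_class[OF Metric_space_axioms C]
    by (simp_all add: x_def)
  have "x \<in> completion_cball (tree_norm T) v 1"
    if v: "v \<in> {prepend2 2 0 0, prepend2 0 2 0, prepend2 2 2 0}" for v
  proof -
    have "?d v (branch_point \<beta> k) \<le> 1 + (1/2) ^ k" for k
    proof -
      have "?d v (branch_point \<beta> k) \<le> real_of_rat (1 + (1/2) ^ k)"
        unfolding norm_dist_def of_rat_less_eq using T v by (rule tree_norm_centre_diff)
      then show ?thesis
        by (simp add: of_rat_add of_rat_power of_rat_divide)
    qed
    moreover have "(\<lambda>k. ?d v (branch_point \<beta> k)) \<longlonglongrightarrow> completion_dist ?d (completion_embed ?d v) x"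
      using completion_dist_tendsto[OF Metric_space_axioms completion_embed_in[OF Metric_space_axioms] x(1)
          const_in_completion_embed[OF Metric_space_axioms] x(2)] .
    moreover have "(\<lambda>k. 1 + (1/2 :: real) ^ k) \<longlonglongrightarrow> 1 + 0"
      by (intro tendsto_intros null)
    ultimately have "completion_dist ?d (completion_embed ?d v) x \<le> 1 + 0"
      by (intro LIMSEQ_le) auto
    then show ?thesis
      using x(1) by (simp add: in_completion_cball rat_norm_tree_norm)
  qed
  then show ?thesis
    by blast
qed

lemma ball_intersection_iff_branch:
  "completion_cball (tree_norm T) (prepend2 2 0 0) 1 \<inter>
    completion_cball (tree_norm T) (prepend2 0 2 0) 1 \<inter>
    completion_cball (tree_norm T) (prepend2 2 2 0) 1 \<noteq> {} \<longleftrightarrow> (\<exists>\<beta>. \<forall>m. T (branch \<beta> m))"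
  using branch_of_ball_intersection[of _ T] ball_intersection_of_branch[of T] by blast

section \<open>Computability of the norm\<close>

text \<open>
  Codes of lists and codes of nodes are the same, so the tail of a list is computed by \<open>parent\<close>
  and its head by \<open>label\<close>. Beyond the end of the list this returns \<open>0\<close>, which codes the fraction
  with denominator \<open>0\<close>, that is, the number \<open>0\<close>.
\<close>

lemma lookup_decode_N:
  "Poly_Mapping.lookup (decode_N c) i = nat_to_rat_surj (label ((parent ^^ i) c))"
proof -
  have zero: "nat_to_rat_surj 0 = 0"
    by (simp add: nat_to_rat_surj_def prod_decode_0 int_decode_def sum_decode_def rat_number_collapse)
  have "nth_default 0 (map nat_to_rat_surj (list_decode c)) i = nat_to_rat_surj (label ((parent ^^ i) c))"
  proof (induction i arbitrary: c)
    case 0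
    show ?case
      by (cases c) (auto simp: nth_default_def zero label_def prod_decode_0 split: prod.split)
  next
    case (Suc i)
    show ?case
    proof (cases c)
      case 0
      have "(parent ^^ Suc i) 0 = 0"
        by (induction i) auto
      then show ?thesis
        by (simp add: 0 nth_default_def zero)
    next
      case (Suc c')
      have "nth_default 0 (map nat_to_rat_surj (list_decode c)) (Suc i) =
          nth_default 0 (map nat_to_rat_surj (list_decode (parent c))) i"
        by (simp add: Suc parent_def split_beta)
      then show ?thesis
        using Suc.IH[of "parent c"] by (simp add: funpow_swap1)
    qed
  qed
  then show ?thesis
    by (simp add: decode_N_def Poly_Mapping.nth.rep_eq)
qed

text \<open>
  A list is not longer than its code, so the code bounds the support and can serve as the bound
  of all sums in the norm.
\<close>

lemma lookup_decode_N_beyond: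
  assumes "c \<le> i"
  shows "Poly_Mapping.lookup (decode_N c) i = 0"
proof -
  have "length (list_decode c) \<le> c" for c
  proof (induction c rule: less_induct)
    case (less c)
    show ?case
    proof (cases c)
      case (Suc c')
      have "psnd c' \<le> c'"
        using le_prod_encode_2[of "psnd c'" "pfst c'"] by simp
      then show ?thesis
        using less[of "psnd c'"] by (auto simp: Suc split_beta)
    qed simp
  qed
  then have "length (list_decode c) \<le> i"
    using assms order_trans by blast
  then show ?thesis
    by (simp add: decode_N_def Poly_Mapping.nth.rep_eq nth_default_def)
qed

lemma computable_norms_tree_norm:
  assumes T: "\<And>k F G. general_recursive k F \<Longrightarrow> general_recursive k G \<Longrightarrow>
      general_recursive k (\<lambda>xs. of_bool (T (F xs) (G xs)))"
  shows "computable_norms (\<lambda>n. tree_norm (T n))"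
proof -
  have coord: "rational_recursive k (\<lambda>xs. Poly_Mapping.lookup (decode_N (F xs)) (G xs))"
    if "general_recursive k F" "general_recursive k G" for k F G
    unfolding lookup_decode_N by (intro rr_nat_to_rat_surj gr_label gr_ancestor that)
  have tail: "rational_recursive k (\<lambda>xs. tail (decode_N (F xs)) (G xs))"
    if "general_recursive k F" "general_recursive k G" for k F G
    unfolding tail_def by (intro coord gr_Suc that)
  have inflow: "rational_recursive k (\<lambda>xs. inflow (F xs) (tail (decode_N (F xs))) (G xs))"
    if "general_recursive k F" "general_recursive k G" for k F G
    unfolding inflow_def
    by (intro rr_sum[where F = "\<lambda>t xs. if t \<noteq> 0 \<and> parent t = G xs then tail (decode_N (F xs)) t else 0"]
        rr_if rr_zero tail gr_intros gr_parent gr_tl that gr_proj) simp_all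
  define c where "c = (\<lambda>xs :: nat list. xs ! 1)"
  have c: "general_recursive 2 c"
    unfolding c_def by (rule gr_proj) simp
  have n: "general_recursive 2 (\<lambda>xs. xs ! 0)"
    by (rule gr_proj) simp
  have defect: "rational_recursive 2 (\<lambda>xs. defect (T (xs ! 0)) (c xs) (tail (decode_N (c xs))))"
    unfolding defect_def
    by (intro rr_sum[where F = "\<lambda>s xs. \<bar>tail (decode_N (c xs)) s / 2 - inflow (c xs) (tail (decode_N (c xs))) s\<bar> +
          (if T (xs ! 0) s then 0 else \<bar>tail (decode_N (c xs)) s\<bar>)"]
        rr_add rr_diff rr_halve rr_abs rr_if rr_zero tail inflow T gr_tl[OF c] gr_tl[OF n] c gr_proj) simp_all
  have "rational_recursive 2 (\<lambda>xs. gauge_upto (T (xs ! 0)) (c xs)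
      (Poly_Mapping.lookup (decode_N (c xs)) 0) (Poly_Mapping.lookup (decode_N (c xs)) 1) (tail (decode_N (c xs))))"
    unfolding gauge_upto_def
    by (intro rr_max rr_add rr_diff rr_halve rr_abs defect coord c gr_const
        rr_sum[where F = "\<lambda>j xs. \<bar>tail (decode_N (c xs)) j\<bar>"] rr_sum[where F = "\<lambda>j xs. tail (decode_N (c xs)) j"]
        tail gr_tl[OF c] gr_proj) simp_all
  then obtain f where f: "general_recursive 2 f" and gauge: "\<And>xs. length xs = 2 \<Longrightarrow>
      gauge_upto (T (xs ! 0)) (c xs) (Poly_Mapping.lookup (decode_N (c xs)) 0)
        (Poly_Mapping.lookup (decode_N (c xs)) 1) (tail (decode_N (c xs))) = nat_to_rat_surj (f xs)"
    by (rule rational_recursive_code) blast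
  have "tree_norm (T n) (decode_N e) = nat_to_rat_surj (f [n, e])" for n e
  proof -
    have "tree_norm (T n) (decode_N e) = gauge_upto (T n) e (Poly_Mapping.lookup (decode_N e) 0)
        (Poly_Mapping.lookup (decode_N e) 1) (tail (decode_N e))"
      by (rule tree_norm_upto) (simp add: tail_def lookup_decode_N_beyond)
    then show ?thesis
      using gauge[of "[n, e]"] by (simp add: c_def)
  qed
  with f show ?thesis
    unfolding computable_norms_def by blast
qed

section \<open>Hyperarithmetical sets and intersections of balls\<close>

theorem corollary2p9:
  fixes C :: "nat set"
  assumes "hyperarithmetical C"
  shows "\<exists>p :: nat \<Rightarrow> N \<Rightarrow> rat.
    (\<forall>n. rat_norm (p n)) \<and> computable_norms p \<and>
    (\<forall>n. completion_cball (p n) (prepend2 2 0 0) 1 \<inter>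
          completion_cball (p n) (prepend2 0 2 0) 1 \<inter>
          completion_cball (p n) (prepend2 2 2 0) 1 \<noteq> {} \<longleftrightarrow> n \<in> C)"
proof -
  obtain T where T: "\<And>k F G. general_recursive k F \<Longrightarrow> general_recursive k G \<Longrightarrow>
      general_recursive k (\<lambda>xs. of_bool (T (F xs) (G xs)))"
    and C: "\<And>n. n \<in> C \<longleftrightarrow> (\<exists>\<beta>. \<forall>m. T n (branch \<beta> m))"
    using assms Sigma11_normal_form unfolding hyperarithmetical_def by metis
  show ?thesis
    by (intro exI[of _ "\<lambda>n. tree_norm (T n)"] conjI allI rat_norm_tree_norm computable_norms_tree_norm T)
      (simp_all only: ball_intersection_iff_branch C)
qed

end
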